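(* Let $c_0=\frac{1}{\log_2 5+1}\approx 0.301$. For every large enough integer $k$ and every small constant $\varepsilon>0$, there exists a graph $G$ with $k$ terminals such that any convex combination of contraction-based flow sparsifiers of $G$ (with respect to its terminals) on at most $k\cdot 2^{(\log k)^{(1-c_0)+\varepsilon}}$ vertices has quality at least $(\log k)^{c_0-O(\varepsilon)}$.
   Context: All logarithms are base 2. Graphs are undirected, edge-capacitated with capacities $c(e)\ge 1$; $\mathrm{dist}_G$ is the unweighted (hop) shortest-path distance. Given a terminal set $T\subseteq V(G)$, a demand $\mathcal D$ assigns a value $\mathcal D_{t,t'}\ge 0$ (not all zero) to each unordered terminal pair; a multicommodity flow routes $\mathcal D$ if it sends $\mathcal D_{t,t'}$ units between $t$ and $t'$ for every pair. The congestion of a flow is $\max_e(\text{flow on } e)/c(e)$, and $\mathrm{cong}_G(\mathcal D)$ is the minimum congestion of a flow routing $\mathcal D$ in $G$. A graph $H$ with $T\subseteq V(H)$ is a flow sparsifier of $G$ w.r.t. $T$ of quality $q\ge1$ if $\mathrm{cong}_H(\mathcal D)\le \mathrm{cong}_G(\mathcal D)\le q\cdot\mathrm{cong}_H(\mathcal D)$ for every demand $\mathcal D$ on $T$. A partition $\mathcal F$ of $V(G)$ is valid if the terminals lie in distinct parts; the contraction-based flow sparsifier given by a valid partition $\mathcal F$ is the graph obtained from $G$ by contracting each part into a single node, keeping parallel edges and deleting self-loops; its size is $|\mathcal F|$. A convex combination of contraction-based flow sparsifiers is a probability distribution $\mu$ over contraction-based flow sparsifiers; it has size at most $s$ if every sparsifier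 in its support has at most $s$ vertices. Its underlying graph $H_\mu$ is obtained by taking a copy of each $H$ in the support, scaling its capacities by $\Pr_\mu[H]$, and identifying all copies of each terminal; the quality of $\mu$ is the quality of $H_\mu$ as a flow sparsifier. *)

theory Defs
  imports Complex_Main "HOL-Probability.Probability_Mass_Function"
begin

text \<open>Undirected edge-capacitated multigraph: each edge e has two endpoints
  (ends e, order irrelevant) and a capacity.\<close>
record ('v, 'e) graph =
  verts :: "'v set"
  edges :: "'e set"
  ends  :: "'e \<Rightarrow> 'v \<times> 'v"
  cap   :: "'e \<Rightarrow> real"

definition wf_graph :: "('v, 'e) graph \<Rightarrow> bool" where
  "wf_graph G \<longleftrightarrow> finite (verts G) \<and> finite (edges G) \<and>
     (\<forall>e\<in>edges G. fst (ends G e) \<in> verts G \<and> snd (ends G e) \<in> verts G \<and>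
        fst (ends G e) \<noteq> snd (ends G e) \<and> cap G e \<ge> 1)"

definition term_pairs :: "'t set \<Rightarrow> 't set set" where
  "term_pairs T = {{a, b} | a b. a \<in> T \<and> b \<in> T \<and> a \<noteq> b}"

definition is_demand :: "'t set \<Rightarrow> ('t set \<Rightarrow> real) \<Rightarrow> bool" where
  "is_demand T D \<longleftrightarrow> (\<forall>p\<in>term_pairs T. D p \<ge> 0) \<and> (\<exists>p\<in>term_pairs T. D p \<noteq> 0)"

text \<open>Net outflow at v of commodity p under a signed edge flow f
  (positive value = flow from fst to snd endpoint).\<close>
definition netout :: "('v, 'e) graph \<Rightarrow> ('t set \<Rightarrow> 'e \<Rightarrow> real) \<Rightarrow> 't set \<Rightarrow> 'v \<Rightarrow> real" where
  "netout G f p v = (\<Sum>e\<in>edges G. (if fst (ends G e) = v then f p e else 0)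
                                   - (if snd (ends G e) = v then f p e else 0))"

definition routes :: "('v, 'e) graph \<Rightarrow> ('t \<Rightarrow> 'v) \<Rightarrow> 't set \<Rightarrow> ('t set \<Rightarrow> real)
                        \<Rightarrow> ('t set \<Rightarrow> 'e \<Rightarrow> real) \<Rightarrow> bool" where
  "routes G pl T D f \<longleftrightarrow> (\<forall>p\<in>term_pairs T. \<exists>a b. a \<in> T \<and> b \<in> T \<and> a \<noteq> b \<and> p = {a, b} \<and>
      (\<forall>v\<in>verts G. netout G f p v =
          D p * ((if v = pl a then 1 else 0) - (if v = pl b then 1 else 0))))"

text \<open>Minimum congestion (infinite if D cannot be routed).\<close>
definition cong :: "('v, 'e) graph \<Rightarrow> ('t \<Rightarrow> 'v) \<Rightarrow> 't set \<Rightarrow> ('t set \<Rightarrow> real) \<Rightarrow> ereal" where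
  "cong G pl T D = Inf {ereal l | l. \<exists>f. routes G pl T D f \<and>
      (\<forall>e\<in>edges G. (\<Sum>p\<in>term_pairs T. \<bar>f p e\<bar>) \<le> l * cap G e)}"

definition flow_sparsifier :: "('v, 'e) graph \<Rightarrow> 'v set \<Rightarrow> ('w, 'f) graph \<Rightarrow> ('v \<Rightarrow> 'w) \<Rightarrow> real \<Rightarrow> bool" where
  "flow_sparsifier G T H plH q \<longleftrightarrow> q \<ge> 1 \<and> plH ` T \<subseteq> verts H \<and> inj_on plH T \<and>
     (\<forall>D. is_demand T D \<longrightarrow>
        cong H plH T D \<le> cong G id T D \<and> cong G id T D \<le> ereal q * cong H plH T D)"

definition valid_partition :: "('v, 'e) graph \<Rightarrow> 'v set \<Rightarrow> 'v set set \<Rightarrow> bool" where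
  "valid_partition G T F \<longleftrightarrow> (\<forall>A\<in>F. A \<noteq> {}) \<and> \<Union>F = verts G \<and>
     (\<forall>A\<in>F. \<forall>B\<in>F. A \<noteq> B \<longrightarrow> A \<inter> B = {}) \<and> (\<forall>A\<in>F. card (A \<inter> T) \<le> 1)"

definition part_of :: "'v set set \<Rightarrow> 'v \<Rightarrow> 'v set" where
  "part_of F v = (THE A. A \<in> F \<and> v \<in> A)"

text \<open>Node of the contracted graph: a part containing terminal t is named Inl t
  (so terminals keep their names), any other part A is named Inr A.\<close>
definition cvert :: "'v set \<Rightarrow> 'v set set \<Rightarrow> 'v \<Rightarrow> 'v + 'v set" where
  "cvert T F v = (if \<exists>t\<in>T. t \<in> part_of F v then Inl (THE t. t \<in> T \<and> t \<in> part_of F v)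
                  else Inr (part_of F v))"

definition contract :: "('v, 'e) graph \<Rightarrow> 'v set \<Rightarrow> 'v set set \<Rightarrow> ('v + 'v set, 'e) graph" where
  "contract G T F = \<lparr> verts = cvert T F ` verts G,
     edges = {e \<in> edges G. part_of F (fst (ends G e)) \<noteq> part_of F (snd (ends G e))},
     ends = (\<lambda>e. (cvert T F (fst (ends G e)), cvert T F (snd (ends G e)))),
     cap = cap G \<rparr>"

definition tag :: "'a \<Rightarrow> 'v + 'b \<Rightarrow> 'v + ('a \<times> 'b)" where
  "tag F x = (case x of Inl t \<Rightarrow> Inl t | Inr A \<Rightarrow> Inr (F, A))"

text \<open>Underlying graph of a convex combination mu (a distribution over valid partitions,
  i.e. over contraction-based sparsifiers): disjoint copies of the contracted graphs,
  capacities scaled by the probabilities, copies of each terminal identified (Inl t).\<close>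
definition Hmu :: "('v, 'e) graph \<Rightarrow> 'v set \<Rightarrow> 'v set set pmf
                     \<Rightarrow> ('v + ('v set set \<times> 'v set), 'v set set \<times> 'e) graph" where
  "Hmu G T mu = \<lparr> verts = Inl ` T \<union> (\<Union>F\<in>set_pmf mu. tag F ` verts (contract G T F)),
     edges = {(F, e) | F e. F \<in> set_pmf mu \<and> e \<in> edges (contract G T F)},
     ends = (\<lambda>(F, e). (tag F (fst (ends (contract G T F) e)), tag F (snd (ends (contract G T F) e)))),
     cap = (\<lambda>(F, e). pmf mu F * cap (contract G T F) e) \<rparr>"

definition conv_comb_size :: "('v, 'e) graph \<Rightarrow> 'v set \<Rightarrow> 'v set set pmf \<Rightarrow> real \<Rightarrow> bool" where
  "conv_comb_size G T mu s \<longleftrightarrow>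
     (\<forall>F\<in>set_pmf mu. valid_partition G T F \<and> real (card (verts (contract G T F))) \<le> s)"

text \<open>The quality of mu (the infimum of q for which H_mu is a flow sparsifier of quality q)
  is at least q0.\<close>
definition quality_at_least :: "('v, 'e) graph \<Rightarrow> 'v set \<Rightarrow> 'v set set pmf \<Rightarrow> real \<Rightarrow> bool" where
  "quality_at_least G T mu q0 \<longleftrightarrow> (\<forall>q. flow_sparsifier G T (Hmu G T mu) Inl q \<longrightarrow> q0 \<le> q)"

definition c0 :: real where "c0 = 1 / (log 2 5 + 1)"

end

theory Submission
  imports Defs "HOL-Real_Asymp.Real_Asymp"
begin

text \<open>
  Let \<open>L = log k\<close>. The hard graph consists of \<open>k\<close> stars with a terminal as hub and \<open>2 ^ l\<close> leaves each,
  where \<open>l\<close> is about \<open>L powr (1 - c0 + \<epsilon>)\<close>, together with a graph of degree at most 4 and average degree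
  almost 4 on the leaves. Spokes have length \<open>l\<close>, links have length 1, and the weighted girth is of
  order \<open>q * l\<close> for \<open>q\<close> of order \<open>L powr (c0 - 2 * \<epsilon>)\<close>; this is possible because \<open>q * l\<close> is much smaller
  than \<open>L\<close>.

  Contract the graph to \<open>k * 2 ^ (l / 3)\<close> vertices and suppose that terminals at distance at most \<open>3 * l\<close>
  in the contracted graph always were at distance at most \<open>3 * l * q\<close> before. Then contracted balls of
  radius \<open>l\<close> stem from small, hence tree-like, regions and have few vertices, so the contracted graph has
  a sparse cover by such balls. Walks inside a tree-like region that have the same ends traverse a link
  the same number of times modulo 2. Hence a set of links is determined by one bit per leaf and one bit
  per incidence of the cover, but the number of links is about twice the number of leaves: a
  contradiction.

  The argument survives the deletion of a small fraction of the edges. So a maximal packing of short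
  routes between far terminals in the contracted graph uses a constant fraction of the total volume,
  and the demand that it serves has congestion at least of order \<open>q\<close> in the original graph by weak
  duality.
\<close>

section \<open>Parities of walks and girth\<close>

text \<open>Edges may be traversed in either direction. On booleans \<open>\<noteq>\<close> is
  exclusive or, so the last argument is the parity of the number of traversals of edges with label
  true; backtracking cancels.\<close>

inductive walk :: "(nat \<times> nat) set \<Rightarrow> (nat \<times> nat \<Rightarrow> nat) \<Rightarrow> (nat \<times> nat \<Rightarrow> bool) \<Rightarrow> nat \<Rightarrow> nat \<Rightarrow> nat \<Rightarrow> bool \<Rightarrow> bool"
  for E len \<omega> x where
  nil: "walk E len \<omega> x x 0 False"
| fwd: "walk E len \<omega> x y d b \<Longrightarrow> (y, z) \<in> E \<Longrightarrow> walk E len \<omega> x z (d + len (y, z)) (b \<noteq> \<omega> (y, z))"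
| bwd: "walk E len \<omega> x y d b \<Longrightarrow> (z, y) \<in> E \<Longrightarrow> walk E len \<omega> x z (d + len (z, y)) (b \<noteq> \<omega> (z, y))"

lemma walk_trans:
  assumes "walk E len \<omega> y z d' b'" "walk E len \<omega> x y d b"
  shows "walk E len \<omega> x z (d + d') (b \<noteq> b')"
  using assms
proof (induction)
  case nil
  then show ?case by simp
next
  case (fwd y' d' b' z)
  have "walk E len \<omega> x z ((d + d') + len (y', z)) ((b \<noteq> b') \<noteq> \<omega> (y', z))"
    by (rule walk.fwd) (use fwd in auto)
  moreover have "((b \<noteq> b') \<noteq> \<omega> (y', z)) = (b \<noteq> (b' \<noteq> \<omega> (y', z)))" by auto
  ultimately show ?case by (simp add: add.assoc)
next
  case (bwd y' d' b' z)
  have "walk E len \<omega> x z ((d + d') + len (z, y')) ((b \<noteq> b') \<noteq> \<omega> (z, y'))"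
    by (rule walk.bwd) (use bwd in auto)
  moreover have "((b \<noteq> b') \<noteq> \<omega> (z, y')) = (b \<noteq> (b' \<noteq> \<omega> (z, y')))" by auto
  ultimately show ?case by (simp add: add.assoc)
qed

lemma walk_edge: "(y, z) \<in> E \<Longrightarrow> walk E len \<omega> y z (len (y, z)) (\<omega> (y, z))"
  using walk.fwd[OF walk.nil, of y z E len \<omega>] by simp

lemma walk_edge_rev: "(z, y) \<in> E \<Longrightarrow> walk E len \<omega> y z (len (z, y)) (\<omega> (z, y))"
  using walk.bwd[OF walk.nil, of z y E len \<omega>] by simp

lemma walk_sym: "walk E len \<omega> x y d b \<Longrightarrow> walk E len \<omega> y x d b"
proof (induction rule: walk.induct)
  case nil
  then show ?case by (rule walk.nil)
next
  case (fwd y d b z)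
  show ?case using walk_trans[OF fwd.IH walk_edge_rev[OF fwd.hyps(2)]]
    by (simp only: add.commute[of "len (y, z)"] neq_commute[of "\<omega> (y, z)"])
next
  case (bwd y d b z)
  show ?case using walk_trans[OF bwd.IH walk_edge[OF bwd.hyps(2)]]
    by (simp only: add.commute[of "len (z, y)"] neq_commute[of "\<omega> (z, y)"])
qed

lemma walk_change_labels: "walk E len \<omega> x y d b \<Longrightarrow> \<exists>b'. walk E len \<omega>' x y d b'"
  by (induction rule: walk.induct) (blast intro: walk.intros)+

text \<open>``Girth larger than \<open>g\<close>'' for edges outside \<open>S\<close>: a closed walk of length at most \<open>g\<close> uses each
  such edge an even number of times. The label \<open>\<omega>\<close> selects the edges whose parity is tracked.\<close>
definition even_girth :: "(nat \<times> nat) set \<Rightarrow> (nat \<times> nat \<Rightarrow> nat) \<Rightarrow> (nat \<times> nat) set \<Rightarrow> nat \<Rightarrow> bool" where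
  "even_girth E len S g \<longleftrightarrow>
     (\<forall>\<omega> x d b. (\<forall>e\<in>S. \<not> \<omega> e) \<longrightarrow> walk E len \<omega> x x d b \<longrightarrow> d \<le> g \<longrightarrow> \<not> b)"

lemma even_girthD:
  "even_girth E len S g \<Longrightarrow> (\<And>e. e \<in> S \<Longrightarrow> \<not> \<omega> e) \<Longrightarrow> walk E len \<omega> x x d b \<Longrightarrow> d \<le> g \<Longrightarrow> \<not> b"
  unfolding even_girth_def by blast

text \<open>Makes the empty set of links admissible in the later maximality argument: labels vanish
  on \<open>S\<close>, so a walk inside \<open>S\<close> collects nothing.\<close>

lemma even_girth_refl: "even_girth S len S g"
proof -
  have "\<not> b" if "walk S len \<omega> x y d b" "\<forall>e\<in>S. \<not> \<omega> e" for \<omega> x y d b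
    using that by (induction rule: walk.induct) auto
  then show ?thesis unfolding even_girth_def by blast
qed

text \<open>A closed walk of length at most \<open>g\<close> must cross the new edge back and forth:
  a single crossing, or two consecutive ones in the same direction, would leave a walk in
  \<open>E\<close> of length at most \<open>g\<close> between its ends. The excursion between a
  crossing and its return is closed in \<open>E\<close>, hence even.\<close>

lemma even_girth_insert:
  assumes girth: "even_girth E len S g"
    and far: "\<And>\<omega> d b. walk E len \<omega> u v d b \<Longrightarrow> d > g"
  shows "even_girth (insert (u, v) E) len S g"
  unfolding even_girth_def
proof (intro allI impI)
  fix \<omega> x d b
  assume S: "\<forall>e\<in>S. \<not> \<omega> e" and closed: "walk (insert (u, v) E) len \<omega> x x d b" and "d \<le> g"
  have far': "d > g" if "walk E len \<omega> v u d b" for d b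
    using far[OF walk_sym[OF that]] .
  \<comment> \<open>Modulo closed excursions in \<open>E\<close>, a short walk uses the new edge at most once.\<close>
  define P where "P y d b \<longleftrightarrow> (\<exists>d'\<le>d. walk E len \<omega> x y d' b) \<or>
      (\<exists>u' v' d1 d2 b1 b2. ((u', v') = (u, v) \<or> (u', v') = (v, u)) \<and> walk E len \<omega> x u' d1 b1 \<and>
          walk E len \<omega> v' y d2 b2 \<and> d1 + d2 \<le> d \<and> b = (b1 \<noteq> (b2 \<noteq> \<omega> (u, v))))" for y d b
  have PI1: "P y d b" if "walk E len \<omega> x y d' b" "d' \<le> d" for y d d' b
    using that unfolding P_def by blast
  have PI2: "P y d b" if "(u', v') = (u, v) \<or> (u', v') = (v, u)" "walk E len \<omega> x u' d1 b1"
    "walk E len \<omega> v' y d2 b2" "d1 + d2 \<le> d" "b = (b1 \<noteq> (b2 \<noteq> \<omega> (u, v)))" for y d b u' v' d1 d2 b1 b2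
    using that unfolding P_def by blast
  have Pcases [consumes 1, case_names old new]: thesis if "P y d b"
    and "\<And>d'. d' \<le> d \<Longrightarrow> walk E len \<omega> x y d' b \<Longrightarrow> thesis"
    and "\<And>u' v' d1 d2 b1 b2. (u', v') = (u, v) \<or> (u', v') = (v, u) \<Longrightarrow> walk E len \<omega> x u' d1 b1 \<Longrightarrow>
      walk E len \<omega> v' y d2 b2 \<Longrightarrow> d1 + d2 \<le> d \<Longrightarrow> b = (b1 \<noteq> (b2 \<noteq> \<omega> (u, v))) \<Longrightarrow> thesis"
    for y d b thesis
    using that unfolding P_def by blast
  have old: "P z (d + d') (b \<noteq> b')" if "P y d b" and w: "walk E len \<omega> y z d' b'" for y z d d' b b'
    using that(1)
  proof (cases rule: Pcases)
    case (old d0)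
    then show "P z (d + d') (b \<noteq> b')" using PI1[OF walk_trans[OF w]] by simp
  next
    case *: (new u' v' d1 d2 b1 b2)
    have "(b \<noteq> b') = (b1 \<noteq> ((b2 \<noteq> b') \<noteq> \<omega> (u, v)))" "d1 + (d2 + d') \<le> d + d'" using * by auto
    with *(1,2) walk_trans[OF w *(3)] show "P z (d + d') (b \<noteq> b')" by (intro PI2)
  qed
  have new: "P z' (d + i) (b \<noteq> \<omega> (u, v))"
    if "P z d b" "d \<le> g" and z: "(z, z') = (u, v) \<or> (z, z') = (v, u)" for z z' d i b
    using that(1)
  proof (cases rule: Pcases)
    case (old d0)
    then show "P z' (d + i) (b \<noteq> \<omega> (u, v))" by (intro PI2[OF z _ walk.nil]) auto
  next
    case *: (new u' v' d1 d2 b1 b2)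
    have "d2 \<le> g" using *(4) \<open>d \<le> g\<close> by simp
    \<comment> \<open>By \<open>far\<close> and \<open>far'\<close> the excursion since the last
      crossing cannot join opposite ends. It is closed and even, the two crossings cancel, and the
      first part alone leads to \<open>z'\<close>.\<close>
    then have "v' = z" using *(1,3) z far far' by fastforce
    then have "\<not> b2" using even_girthD[OF girth] S *(3) \<open>d2 \<le> g\<close> by metis
    then have "(b \<noteq> \<omega> (u, v)) = b1" using *(5) by auto
    moreover have "u' = z'"
    proof (cases "u = v")
      case True
      then show ?thesis using *(1) z by auto
    next
      case False
      then show ?thesis using *(1) z \<open>v' = z\<close> by auto
    qed
    moreover have "d1 \<le> d + i" using *(4) by simp
    ultimately show "P z' (d + i) (b \<noteq> \<omega> (u, v))" using PI1[OF *(2), of "d + i"] by (simp only:)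
  qed
  have inv: "P y d b" if "walk (insert (u, v) E) len \<omega> x y d b" "d \<le> g" for y d b
    using that
  proof (induction rule: walk.induct)
    case nil
    then show ?case using PI1[OF walk.nil] by blast
  next
    case (fwd y d b z)
    then have P: "P y d b" by simp
    show ?case
    proof (cases "(y, z) \<in> E")
      case True
      then show ?thesis using old[OF P walk_edge] by blast
    next
      case False
      then show ?thesis using new[OF P] fwd by auto
    qed
  next
    case (bwd y d b z)
    then have P: "P y d b" by simp
    show ?case
    proof (cases "(z, y) \<in> E")
      case True
      then show ?thesis using old[OF P walk_edge_rev] by blast
    next
      case False
      then show ?thesis using new[OF P] bwd by auto
    qed
  qed
  show "\<not> b"
    using inv[OF closed \<open>d \<le> g\<close>, unfolded P_def]
  proof (elim disjE exE conjE)
    fix d' assume "d' \<le> d" "walk E len \<omega> x x d' b"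
    then show "\<not> b" using even_girthD[OF girth] S \<open>d \<le> g\<close> by (metis le_trans)
  next
    \<comment> \<open>If one crossing is left, the two parts in \<open>E\<close> join at
      \<open>x\<close> to a walk between the ends of the new edge that is too short for
      \<open>far\<close>.\<close>
    fix u' v' d1 d2 b1 b2
    assume "(u', v') = (u, v)" "walk E len \<omega> x u' d1 b1" "walk E len \<omega> v' x d2 b2" "d1 + d2 \<le> d"
    then show "\<not> b"
      using far'[OF walk_trans[of E len \<omega> x u d1 b1 v d2 b2]] \<open>d \<le> g\<close> by simp
  next
    fix u' v' d1 d2 b1 b2
    assume "(u', v') = (v, u)" "walk E len \<omega> x u' d1 b1" "walk E len \<omega> v' x d2 b2" "d1 + d2 \<le> d"
    then show "\<not> b"
      using far[OF walk_trans[of E len \<omega> x v d1 b1 u d2 b2]] \<open>d \<le> g\<close> by simp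
  qed
qed

section \<open>Sparse covers\<close>

text \<open>Ball growing: around each root some ball grows by a factor of at most \<open>\<tau>\<close> in its next step;
  its enlarged version becomes the piece of that root, and the ball itself is removed.\<close>
lemma sparse_cover:
  fixes adj :: "'a \<Rightarrow> 'a \<Rightarrow> bool" and near :: "nat \<Rightarrow> 'a \<Rightarrow> 'a \<Rightarrow> bool" and \<tau> h :: nat
  assumes near0: "\<And>c. near 0 c c"
    and nearSuc: "\<And>j r c c'. near j r c \<Longrightarrow> c = c' \<or> adj c c' \<Longrightarrow> near (Suc j) r c'"
    and sym: "\<And>c c'. adj c c' \<Longrightarrow> adj c' c"
    and small: "\<And>r. r \<in> W \<Longrightarrow> card {c\<in>W. near h r c} < \<tau> ^ h"
    and W: "finite W"
  shows "\<exists>Y \<subseteq> W \<times> W. card Y \<le> \<tau> * card W \<and> (\<forall>(r, c)\<in>Y. near h r c) \<and>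
      (\<forall>c\<in>W. \<forall>c'\<in>W. c = c' \<or> adj c c' \<longrightarrow> (\<exists>r. (r, c) \<in> Y \<and> (r, c') \<in> Y))"
proof -
  have mono: "near (j + i) r c" if "near j r c" for j i r c
    using that by (induction i) (auto intro: nearSuc)
  \<comment> \<open>Generalised to subsets \<open>U\<close>, so that induction covers what is left
    after a ball is removed.\<close>
  have "\<exists>Y \<subseteq> U \<times> U. card Y \<le> \<tau> * card U \<and> (\<forall>(r, c)\<in>Y. near h r c) \<and>
      (\<forall>c\<in>U. \<forall>c'\<in>U. c = c' \<or> adj c c' \<longrightarrow> (\<exists>r. (r, c) \<in> Y \<and> (r, c') \<in> Y))"
    if "U \<subseteq> W" for U
    using finite_subset[OF that W] that
  proof (induction U rule: finite_psubset_induct)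
    case (psubset U)
    show ?case
    proof (cases "U = {}")
      case True
      then show ?thesis by auto
    next
      case False
      then obtain r where r: "r \<in> U" by auto
      \<comment> \<open>The ball of radius \<open>j\<close> around \<open>r\<close> inside the
        remaining set \<open>U\<close>.\<close>
      define B where "B = rec_nat {r} (\<lambda>_ X. X \<union> {c'\<in>U. \<exists>c\<in>X. adj c c'})"
      have B0: "B 0 = {r}" and BS: "\<And>j. B (Suc j) = B j \<union> {c'\<in>U. \<exists>c\<in>B j. adj c c'}"
        by (auto simp: B_def)
      have BU: "B j \<subseteq> U" for j by (induction j) (auto simp: B0 BS r)
      have Bfin: "finite (B j)" for j using BU psubset.hyps finite_subset by blast
      have Bnear: "near j r c" if "c \<in> B j" for j c
        using that by (induction j arbitrary: c) (auto simp: B0 BS intro: near0 nearSuc)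
      have rB: "r \<in> B j" for j by (induction j) (auto simp: B0 BS)
      \<comment> \<open>Otherwise \<open>h\<close> successive steps each grow the ball by a factor
        of at least \<open>\<tau>\<close>, against \<open>small\<close>.\<close>
      have "\<exists>j<h. card (B (Suc j)) \<le> \<tau> * card (B j)"
      proof (rule ccontr)
        assume neg: "\<not> ?thesis"
        have "j \<le> h \<Longrightarrow> \<tau> ^ j \<le> card (B j)" for j
        proof (induction j)
          case 0
          then show ?case by (simp add: B0)
        next
          case (Suc j)
          then have "\<tau> * \<tau> ^ j \<le> \<tau> * card (B j)" by simp
          also have "\<dots> \<le> card (B (Suc j))" using neg Suc.prems by (meson Suc_le_eq linorder_le_cases)
          finally show ?case by simp
        qed
        then have "\<tau> ^ h \<le> card (B h)" by simp
        also have "\<dots> \<le> card {c\<in>W. near h r c}"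
          by (rule card_mono) (use W BU psubset.prems Bnear in auto)
        finally show False using small[of r] r psubset.prems by force
      qed
      then obtain j where j: "j < h" "card (B (Suc j)) \<le> \<tau> * card (B j)" by auto
      have less: "U - B j \<subset> U" using r rB by blast
      have UW: "U - B j \<subseteq> W" using psubset.prems by blast
      obtain Y where Y: "Y \<subseteq> (U - B j) \<times> (U - B j)"
        "card Y \<le> \<tau> * card (U - B j)" "\<forall>(r, c)\<in>Y. near h r c"
        "\<forall>c\<in>U - B j. \<forall>c'\<in>U - B j. c = c' \<or> adj c c' \<longrightarrow> (\<exists>r. (r, c) \<in> Y \<and> (r, c') \<in> Y)"
        using psubset.IH[OF less UW] by (elim exE conjE) (rule that)
      let ?Y = "{r} \<times> B (Suc j) \<union> Y"
      have "card ?Y \<le> card ({r} \<times> B (Suc j)) + card Y" by (rule card_Un_le)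
      also have "card ({r} \<times> B (Suc j)) = card (B (Suc j))"
        by (simp add: card_cartesian_product)
      \<comment> \<open>The new piece is charged to the removed ball \<open>B j\<close>; removed
        balls are disjoint, so the charges add up to \<open>\<tau> * card U\<close>.\<close>
      also have "card (B (Suc j)) + card Y \<le> \<tau> * (card (B j) + card (U - B j))"
        using j Y(2) by (simp add: distrib_left)
      also have "card (B j) + card (U - B j) = card U"
        by (metis BU Bfin card_Diff_subset card_mono le_add_diff_inverse psubset.hyps)
      finally have "card ?Y \<le> \<tau> * card U" .
      moreover have "?Y \<subseteq> U \<times> U" using Y(1) BU[of "Suc j"] r by blast
      moreover have "\<forall>(r', c)\<in>?Y. near h r' c"
        using Y(3) Bnear[of _ "Suc j"] mono[of "Suc j" r _ "h - Suc j"] j(1) by auto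
      \<comment> \<open>A pair touching the removed ball lies entirely in the enlarged one.\<close>
      moreover have "\<exists>r'. (r', c) \<in> ?Y \<and> (r', c') \<in> ?Y" if "c \<in> U" "c' \<in> U" "c = c' \<or> adj c c'" for c c'
      proof (cases "c \<in> B j \<or> c' \<in> B j")
        case True
        then have "c \<in> B (Suc j) \<and> c' \<in> B (Suc j)" using that sym by (auto simp: BS)
        then show ?thesis by blast
      next
        case False
        then show ?thesis using Y(4) that by blast
      qed
      ultimately show ?thesis by (intro exI[of _ ?Y]) auto
    qed
  qed
  then show ?thesis by blast
qed

section \<open>The hard graph\<close>

locale star_system =
  fixes k l :: nat
  assumes l_pos: "0 < l"
begin

text \<open>Vertices are numbers: the hubs are those below \<open>k\<close>, and the leaves follow
  in blocks of \<open>2 ^ l\<close>, one per hub. Spokes are written hub first and links smaller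
  leaf first, so each undirected edge is a single pair whose first component tells its kind.\<close>

definition leaves :: "nat set" where "leaves = {k..<k + k * 2 ^ l}"
definition hub :: "nat \<Rightarrow> nat" where "hub v = (v - k) div 2 ^ l"
definition spokes :: "(nat \<times> nat) set" where "spokes = (\<lambda>v. (hub v, v)) ` leaves"
definition len :: "nat \<times> nat \<Rightarrow> nat" where "len e = (if fst e < k then l else 1)"
definition links :: "(nat \<times> nat) set" where "links = {(u, v). u \<in> leaves \<and> v \<in> leaves \<and> u < v}"
definition incident :: "(nat \<times> nat) set \<Rightarrow> nat \<Rightarrow> (nat \<times> nat) set" where
  "incident H v = {e\<in>H. fst e = v \<or> snd e = v}"
text \<open>Lengths do not depend on labels (\<open>walk_change_labels\<close>), so the constant
  label describes the ball for all labels.\<close>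

definition reach :: "(nat \<times> nat) set \<Rightarrow> nat \<Rightarrow> nat \<Rightarrow> nat set" where
  "reach E r x = {y. \<exists>d\<le>r. \<exists>b. walk E len (\<lambda>_. False) x y d b}"

lemma finite_leaves [simp]: "finite leaves" by (simp add: leaves_def)
lemma card_leaves: "card leaves = k * 2 ^ l" by (simp add: leaves_def)
lemma finite_links [simp]: "finite links"
  by (rule finite_subset[of _ "leaves \<times> leaves"]) (auto simp: links_def)
lemma finite_spokes [simp]: "finite spokes" by (simp add: spokes_def)
lemma hub_less: "v \<in> leaves \<Longrightarrow> hub v < k"
  unfolding leaves_def hub_def by (auto intro!: less_mult_imp_div_less)
lemma len_spoke: "e \<in> spokes \<Longrightarrow> len e = l" by (auto simp: spokes_def len_def hub_less)
lemma len_link: "e \<in> links \<Longrightarrow> len e = 1" by (auto simp: links_def len_def leaves_def)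

lemma reach_walk: "walk E len \<omega> x y d b \<Longrightarrow> d \<le> r \<Longrightarrow> y \<in> reach E r x"
  unfolding reach_def using walk_change_labels by blast

lemma spoke_neighbours: "card {z. (y, z) \<in> spokes \<or> (z, y) \<in> spokes} \<le> 2 * 2 ^ l"
  and finite_spoke_neighbours: "finite {z. (y, z) \<in> spokes \<or> (z, y) \<in> spokes}"
proof -
  let ?A = "insert (hub y) {k + y * 2 ^ l..<k + y * 2 ^ l + 2 ^ l}"
  have "z \<in> {k + hub z * 2 ^ l..<k + hub z * 2 ^ l + 2 ^ l}" if "z \<in> leaves" for z
  proof -
    have "hub z * 2 ^ l \<le> z - k" "z - k < hub z * 2 ^ l + 2 ^ l"
      unfolding hub_def using dividend_less_div_times[of "2 ^ l" "z - k"] by (auto simp: div_times_less_eq_dividend)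
    then show ?thesis using that by (auto simp: leaves_def)
  qed
  then have sub: "{z. (y, z) \<in> spokes \<or> (z, y) \<in> spokes} \<subseteq> ?A"
    by (auto simp: spokes_def)
  then show "finite {z. (y, z) \<in> spokes \<or> (z, y) \<in> spokes}" by (rule finite_subset) simp
  have "card {z. (y, z) \<in> spokes \<or> (z, y) \<in> spokes} \<le> card ?A" using sub by (intro card_mono) auto
  also have "\<dots> \<le> Suc (2 ^ l)" by (rule order.trans[OF card_insert_le_m1]) auto
  also have "\<dots> \<le> 2 * 2 ^ l" by simp
  finally show "card {z. (y, z) \<in> spokes \<or> (z, y) \<in> spokes} \<le> 2 * 2 ^ l" .
qed

lemma link_neighbours:
  assumes "H \<subseteq> links" "card (incident H y) \<le> 4"
  shows "card {z. (y, z) \<in> H \<or> (z, y) \<in> H} \<le> 4" "finite {z. (y, z) \<in> H \<or> (z, y) \<in> H}"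
proof -
  have fin: "finite (incident H y)" unfolding incident_def using assms finite_subset[OF _ finite_links] by simp
  have sub: "{z. (y, z) \<in> H \<or> (z, y) \<in> H} \<subseteq> (\<lambda>e. if fst e = y then snd e else fst e) ` incident H y"
    (is "_ \<subseteq> ?f ` _")
  proof
    fix z assume "z \<in> {z. (y, z) \<in> H \<or> (z, y) \<in> H}"
    then have "(y, z) \<in> incident H y \<and> z = ?f (y, z) \<or> (z, y) \<in> incident H y \<and> z = ?f (z, y)"
      by (auto simp: incident_def)
    then show "z \<in> ?f ` incident H y" by blast
  qed
  show "card {z. (y, z) \<in> H \<or> (z, y) \<in> H} \<le> 4"
    using surj_card_le[OF fin sub] assms(2) by (rule le_trans)
  show "finite {z. (y, z) \<in> H \<or> (z, y) \<in> H}" by (rule finite_surj[OF fin sub])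
qed

text \<open>Vertices are classified by the last edge of a walk. A link costs 1 and offers 4 choices,
  a spoke costs \<open>l\<close> and offers at most \<open>2 * 2 ^ l\<close>; the length of the
  spokes thus compensates for the degree of the hubs. With base 16, either kind accounts for at most
  a quarter of \<open>16 ^ r\<close>.\<close>

lemma card_reach:
  assumes H: "H \<subseteq> links" and deg: "\<And>v. card (incident H v) \<le> 4"
  shows "finite (reach (spokes \<union> H) r x) \<and> card (reach (spokes \<union> H) r x) \<le> 16 ^ r"
proof (induction r rule: less_induct)
  case (less r)
  let ?R = "\<lambda>r. reach (spokes \<union> H) r x"
  let ?SN = "\<lambda>y. {z. (y, z) \<in> spokes \<or> (z, y) \<in> spokes}"
  let ?HN = "\<lambda>y. {z. (y, z) \<in> H \<or> (z, y) \<in> H}"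
  define A where "A = (if 1 \<le> r then \<Union> (?HN ` ?R (r - 1)) else {})"
  define B where "B = (if l \<le> r then \<Union> (?SN ` ?R (r - l)) else {})"
  have "?R r \<subseteq> {x} \<union> A \<union> B"
  proof
    fix z assume "z \<in> ?R r"
    then obtain d b where "d \<le> r" "walk (spokes \<union> H) len (\<lambda>_. False) x z d b"
      by (auto simp: reach_def)
    from this(2,1) show "z \<in> {x} \<union> A \<union> B"
    proof cases
      case nil
      then show ?thesis by simp
    next
      case (fwd y d' b')
      show ?thesis
      proof (cases "(y, z) \<in> spokes")
        case True
        with fwd \<open>d \<le> r\<close> have "l \<le> r" "y \<in> ?R (r - l)" by (auto simp: len_spoke intro!: reach_walk)
        then show ?thesis using True by (auto simp: B_def)
      next
        case False
        with fwd have "(y, z) \<in> H" by simp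
        with fwd \<open>d \<le> r\<close> H have "1 \<le> r" "y \<in> ?R (r - 1)" by (auto simp: len_link subset_iff intro!: reach_walk)
        then show ?thesis using \<open>(y, z) \<in> H\<close> by (auto simp: A_def)
      qed
    next
      case (bwd y d' b')
      show ?thesis
      proof (cases "(z, y) \<in> spokes")
        case True
        with bwd \<open>d \<le> r\<close> have "l \<le> r" "y \<in> ?R (r - l)" by (auto simp: len_spoke intro!: reach_walk)
        then show ?thesis using True by (auto simp: B_def)
      next
        case False
        with bwd have "(z, y) \<in> H" by simp
        with bwd \<open>d \<le> r\<close> H have "1 \<le> r" "y \<in> ?R (r - 1)" by (auto simp: len_link subset_iff intro!: reach_walk)
        then show ?thesis using \<open>(z, y) \<in> H\<close> by (auto simp: A_def)
      qed
    qed
  qed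
  moreover have A: "finite A \<and> 4 * card A \<le> 16 ^ r"
  proof (cases "1 \<le> r")
    case True
    then have IH: "finite (?R (r - 1))" "card (?R (r - 1)) \<le> 16 ^ (r - 1)" using less.IH[of "r - 1"] by auto
    have "card A \<le> (\<Sum>y\<in>?R (r - 1). card (?HN y))"
      unfolding A_def using True IH(1) by (simp add: card_UN_le)
    also have "\<dots> \<le> (\<Sum>y\<in>?R (r - 1). 4)"
      by (rule sum_mono) (rule link_neighbours(1)[OF H deg])
    also have "\<dots> \<le> 16 ^ (r - 1) * 4" using IH(2) by simp
    finally have "4 * card A \<le> 16 * 16 ^ (r - 1)" by simp
    also have "(16::nat) * 16 ^ (r - 1) = 16 ^ r" using True by (cases r) auto
    finally show ?thesis using IH(1) link_neighbours(2)[OF H deg] True by (simp add: A_def)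
  qed (simp add: A_def)
  moreover have B: "finite B \<and> 4 * card B \<le> 16 ^ r"
  proof (cases "l \<le> r")
    case True
    then have IH: "finite (?R (r - l))" "card (?R (r - l)) \<le> 16 ^ (r - l)"
      using less.IH[of "r - l"] l_pos by auto
    have "card B \<le> (\<Sum>y\<in>?R (r - l). card (?SN y))"
      unfolding B_def using True IH(1) by (simp add: card_UN_le)
    also have "\<dots> \<le> (\<Sum>y\<in>?R (r - l). 2 * 2 ^ l)"
      by (rule sum_mono) (rule spoke_neighbours)
    also have "\<dots> \<le> 16 ^ (r - l) * (2 * 2 ^ l)" using IH(2) by simp
    finally have "4 * card B \<le> 16 ^ (r - l) * (8 * 2 ^ l)" by (simp add: mult_ac)
    also have "(8::nat) * 2 ^ l \<le> 8 ^ l * 2 ^ l" using l_pos self_le_power[of "8::nat" l] by simp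
    also have "(8::nat) ^ l * 2 ^ l = 16 ^ l" by (simp flip: power_mult_distrib)
    also have "(16::nat) ^ (r - l) * 16 ^ l = 16 ^ r" using True by (simp flip: power_add)
    finally show ?thesis using IH(1) finite_spoke_neighbours True by (simp add: B_def)
  qed (simp add: B_def)
  ultimately have fin: "finite (?R r)" and c: "card (?R r) \<le> card ({x} \<union> A \<union> B)"
    by (auto intro: finite_subset card_mono)
  \<comment> \<open>The summand 1 is the start \<open>x\<close>, the only vertex for
    \<open>r = 0\<close> because all lengths are positive.\<close>
  have "card ({x} \<union> A \<union> B) \<le> 1 + card A + card B"
    using card_Un_le[of "{x} \<union> A" B] card_Un_le[of "{x}" A] by simp
  moreover have "2 \<le> (16::nat) ^ r" if "r \<noteq> 0" using that self_le_power[of "16::nat" r] by simp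
  moreover have "A = {} \<and> B = {}" if "r = 0" using that l_pos by (simp add: A_def B_def)
  ultimately have "card (?R r) \<le> 16 ^ r" using c A B by (cases "r = 0") auto
  with fin show ?case by simp
qed

lemma sum_card_incident:
  assumes "H \<subseteq> links"
  shows "(\<Sum>v\<in>leaves. card (incident H v)) = 2 * card H"
proof -
  have fin: "finite H" using assms finite_links finite_subset by blast
  have "card (incident H v) = (\<Sum>e\<in>H. (if fst e = v then 1 else 0) + (if snd e = v then 1 else 0))" for v
  proof -
    have "card (incident H v) = (\<Sum>e\<in>H. if fst e = v \<or> snd e = v then 1 else 0)"
      unfolding incident_def using fin by (simp add: sum.If_cases Int_def)
    also have "\<dots> = (\<Sum>e\<in>H. (if fst e = v then 1 else 0) + (if snd e = v then 1 else 0))"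
      using assms by (intro sum.cong) (auto simp: links_def)
    finally show ?thesis .
  qed
  then have "(\<Sum>v\<in>leaves. card (incident H v)) =
      (\<Sum>e\<in>H. \<Sum>v\<in>leaves. (if fst e = v then 1 else 0) + (if snd e = v then 1 else 0))"
    using sum.swap by simp
  also have "\<dots> = (\<Sum>e\<in>H. 2)"
    using assms by (intro sum.cong) (auto simp: sum.distrib links_def)
  finally show ?thesis by simp
qed

text \<open>A maximal set of links of degree at most 4 and large girth: two leaves of smaller degree are
  at distance at most \<open>g\<close>, so all of them lie in one ball.\<close>
lemma high_girth_links:
  assumes "1 \<le> g"
  obtains H where "H \<subseteq> links" "\<And>v. card (incident H v) \<le> 4" "even_girth (spokes \<union> H) len spokes g"
    "4 * (k * 2 ^ l) \<le> 2 * card H + 4 * 16 ^ g"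
proof -
  define good where "good H \<longleftrightarrow> H \<subseteq> links \<and> (\<forall>v. card (incident H v) \<le> 4) \<and>
      even_girth (spokes \<union> H) len spokes g" for H
  have "good {}" by (simp add: good_def incident_def even_girth_refl)
  moreover have "\<forall>H. good H \<longrightarrow> card H < Suc (card links)"
    by (auto simp: good_def less_Suc_eq_le intro: card_mono)
  ultimately obtain H where H: "good H" and max: "\<And>H'. good H' \<Longrightarrow> card H' \<le> card H"
    using ex_has_greatest_nat[of good "{}" card "Suc (card links)"] by blast
  have sub: "H \<subseteq> links" and deg: "\<And>v. card (incident H v) \<le> 4"
    and girth: "even_girth (spokes \<union> H) len spokes g"
    using H by (auto simp: good_def)
  have fin: "finite H" using sub finite_links finite_subset by blast
  define low where "low = {v\<in>leaves. card (incident H v) < 4}"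
  have close: "v \<in> reach (spokes \<union> H) g u \<and> u \<in> reach (spokes \<union> H) g v"
    if uv: "u \<in> low" "v \<in> low" "u < v" for u v
  proof (rule ccontr)
    assume neg: "\<not> ?thesis"
    have far: "d > g" if "walk (spokes \<union> H) len \<omega> u v d b" for \<omega> d b
      using reach_walk[OF that, of g] reach_walk[OF walk_sym[OF that], of g] neg by force
    have link: "(u, v) \<in> links" using uv by (auto simp: links_def low_def)
    \<comment> \<open>An existing link would be a walk of length 1, at most
      \<open>g\<close>.\<close>
    have "(u, v) \<notin> H"
      using far[OF walk_edge[of u v "spokes \<union> H" len "\<lambda>_. False"]] len_link[OF link] assms by auto
    have "card (incident (insert (u, v) H) w) \<le> 4" for w
    proof (cases "w = u \<or> w = v")
      case True
      then have "incident (insert (u, v) H) w = insert (u, v) (incident H w)" by (auto simp: incident_def)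
      moreover have "card (incident H w) < 4" using True uv by (auto simp: low_def)
      ultimately show ?thesis using card_insert_le_m1[of 4 "incident H w"] by simp
    next
      case False
      then have "incident (insert (u, v) H) w = incident H w" by (auto simp: incident_def)
      then show ?thesis using deg by simp
    qed
    moreover have "even_girth (spokes \<union> insert (u, v) H) len spokes g"
      using even_girth_insert[OF girth far] by simp
    ultimately have "good (insert (u, v) H)" using link sub by (simp add: good_def)
    from max[OF this] show False using fin \<open>(u, v) \<notin> H\<close> by simp
  qed
  have low: "card low \<le> 16 ^ g"
  proof (cases "low = {}")
    case False
    then obtain u where u: "u \<in> low" by blast
    have "u \<in> reach (spokes \<union> H) g u" by (rule reach_walk[OF walk.nil]) simp
    then have "v \<in> reach (spokes \<union> H) g u" if "v \<in> low" for v
      using close[of u v] close[of v u] that u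
      by (cases u v rule: linorder_cases) auto
    then have "card low \<le> card (reach (spokes \<union> H) g u)"
      using card_reach[OF sub deg] by (intro card_mono) auto
    then show ?thesis using card_reach[OF sub deg, of g u] by linarith
  qed simp
  \<comment> \<open>Leaves outside \<open>low\<close> have degree 4, and all degrees sum to
    \<open>2 * card H\<close>; the ball bound pays for \<open>low\<close>.\<close>
  have "4 * (k * 2 ^ l) = 4 * card leaves" by (simp add: card_leaves)
  also have "card leaves = card low + card (leaves - low)"
    using card_Diff_subset[of low leaves] card_mono[of leaves low] by (auto simp: low_def)
  also have "4 * (card low + card (leaves - low)) = 4 * card low + (\<Sum>v\<in>leaves - low. 4)" by simp
  also have "(\<Sum>v\<in>leaves - low. 4) \<le> (\<Sum>v\<in>leaves - low. card (incident H v))"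
    by (rule sum_mono) (auto simp: low_def)
  also have "\<dots> \<le> (\<Sum>v\<in>leaves. card (incident H v))" by (rule sum_mono2) auto
  finally have "4 * (k * 2 ^ l) \<le> 2 * card H + 4 * 16 ^ g"
    using low by (simp add: sum_card_incident[OF sub])
  then show thesis using that sub deg girth by blast
qed

end

section \<open>Short routes in contracted graphs\<close>

text \<open>With \<open>n = k * 2 ^ l\<close> leaves, \<open>H\<close> has at least
  \<open>15 / 8 * n\<close> of the at most \<open>2 * n\<close> links that degree 4 permits.
  Contracted graphs will have at most \<open>k * 2 ^ w\<close> vertices. The girth is
  \<open>4 * R + 1\<close> for the \<open>R\<close> below, and \<open>20 * q < w\<close> keeps balls
  of radius \<open>R\<close> smaller than \<open>(2 ^ w) ^ l\<close>.\<close>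

locale sparse_net = star_system +
  fixes w q :: nat and H :: "(nat \<times> nat) set"
  assumes k_pos: "0 < k" and l_eq: "l = 3 * w" and q_pos: "0 < q" and w_large: "20 * q < w"
    and H_links: "H \<subseteq> links" and degree: "\<And>v. card (incident H v) \<le> 4"
    and girth: "even_girth (spokes \<union> H) len spokes (4 * (3 * l * q + 2 * l) + 1)"
    and H_large: "15 * (k * 2 ^ l) \<le> 8 * card H"
begin

abbreviation (input) E where "E \<equiv> spokes \<union> H"

text \<open>Reaches from leaf to leaf when the hubs are not far: \<open>3 * l * q\<close> between
  the hubs and one spoke at either end.\<close>

definition R :: nat where "R = 3 * l * q + 2 * l"

text \<open>Short routes after contraction will have length at most \<open>3 * l\<close>, so far
  pairs witness a stretch beyond \<open>q\<close>.\<close>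

definition far :: "nat \<Rightarrow> nat \<Rightarrow> bool" where
  "far t t' \<longleftrightarrow> (\<forall>\<omega> d b. walk E len \<omega> t t' d b \<longrightarrow> 3 * l * q < d)"

text \<open>For labels vanishing on the spokes, the girth makes all walks of length at most
  \<open>R\<close> between \<open>x\<close> and \<open>y\<close> agree; the existential form picks
  their common parity.\<close>

definition parity :: "(nat \<times> nat \<Rightarrow> bool) \<Rightarrow> nat \<Rightarrow> nat \<Rightarrow> bool" where
  "parity \<omega> x y \<longleftrightarrow> (\<exists>d\<le>R. walk E len \<omega> x y d True)"

lemma finite_H: "finite H" using H_links finite_links finite_subset by blast

lemma parity_walk:
  assumes \<omega>: "\<And>e. e \<in> spokes \<Longrightarrow> \<not> \<omega> e" and "y \<in> reach E R x"
  shows "\<exists>d\<le>R. walk E len \<omega> x y d (parity \<omega> x y)"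
proof -
  obtain d b where "d \<le> R" "walk E len (\<lambda>_. False) x y d b" using assms(2) by (auto simp: reach_def)
  then obtain b where "walk E len \<omega> x y d b" using walk_change_labels by blast
  show ?thesis
  proof (cases "parity \<omega> x y")
    case True
    moreover from this obtain d where "d \<le> R" "walk E len \<omega> x y d True" by (auto simp: parity_def)
    ultimately show ?thesis by auto
  next
    case False
    moreover from this have "\<not> b" using \<open>d \<le> R\<close> \<open>walk E len \<omega> x y d b\<close> by (auto simp: parity_def)
    ultimately show ?thesis using \<open>d \<le> R\<close> \<open>walk E len \<omega> x y d b\<close> by auto
  qed
qed

text \<open>The walks from \<open>r\<close> via \<open>c\<close>, \<open>u\<close>, \<open>v\<close>
  and \<open>c'\<close> back to \<open>r\<close> form a closed walk of length at most
  \<open>4 * R + 1\<close>, which is even by the girth.\<close>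

lemma parity_link:
  assumes \<omega>: "\<And>e. e \<in> spokes \<Longrightarrow> \<not> \<omega> e" and uv: "(u, v) \<in> H"
    and "c \<in> reach E R r" "c' \<in> reach E R r" "u \<in> reach E R c" "v \<in> reach E R c'"
  shows "\<omega> (u, v) \<longleftrightarrow> ((parity \<omega> r c \<noteq> parity \<omega> c u) \<noteq> (parity \<omega> r c' \<noteq> parity \<omega> c' v))"
proof -
  note ex = parity_walk[where \<omega>=\<omega>, OF \<omega>]
  obtain d1 where 1: "d1 \<le> R" "walk E len \<omega> r c d1 (parity \<omega> r c)" using ex assms(3) by blast
  obtain d2 where 2: "d2 \<le> R" "walk E len \<omega> c u d2 (parity \<omega> c u)" using ex assms(5) by blast
  obtain d3 where 3: "d3 \<le> R" "walk E len \<omega> r c' d3 (parity \<omega> r c')" using ex assms(4) by blast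
  obtain d4 where 4: "d4 \<le> R" "walk E len \<omega> c' v d4 (parity \<omega> c' v)" using ex assms(6) by blast
  have uv': "walk E len \<omega> u v 1 (\<omega> (u, v))"
    using walk_edge[of u v E len \<omega>] uv len_link[of "(u, v)"] H_links by auto
  note closed = walk_trans[OF walk_sym[OF 3(2)] walk_trans[OF walk_sym[OF 4(2)]
      walk_trans[OF uv' walk_trans[OF 2(2) 1(2)]]]]
  have "\<not> ((((parity \<omega> r c \<noteq> parity \<omega> c u) \<noteq> \<omega> (u, v)) \<noteq> parity \<omega> c' v) \<noteq> parity \<omega> r c')"
    by (rule even_girthD[OF girth _ closed]) (use \<omega> 1(1) 2(1) 3(1) 4(1) in \<open>auto simp: R_def\<close>)
  then show ?thesis by auto
qed

text \<open>If every pair of hubs joined by a short route after contracting along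
  \<open>f\<close> were close in the net, then by the girth the parity of \<open>\<omega>\<close> along short walks would be well defined on
  all pieces of a sparse cover of the contracted graph, and a set \<open>\<omega> \<subseteq> H1\<close> would be determined
  by one bit per leaf and one bit per incidence of the cover.\<close>
lemma shortcut:
  fixes f :: "nat \<Rightarrow> 'a" and near :: "nat \<Rightarrow> 'a \<Rightarrow> 'a \<Rightarrow> bool"
  assumes V1: "V1 \<subseteq> leaves" and H1: "H1 \<subseteq> H" "\<And>u v. (u, v) \<in> H1 \<Longrightarrow> u \<in> V1 \<and> v \<in> V1"
    and near0: "\<And>c. near 0 c c"
    and nearSuc: "\<And>j r c. near j r c \<Longrightarrow> near (Suc j) r c"
      "\<And>j r u v. (u, v) \<in> H1 \<Longrightarrow> near j r (f u) \<Longrightarrow> near (Suc j) r (f v)"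
      "\<And>j r u v. (u, v) \<in> H1 \<Longrightarrow> near j r (f v) \<Longrightarrow> near (Suc j) r (f u)"
    and few: "card (f ` V1) \<le> k * 2 ^ w"
    and many: "3 * (k * 2 ^ l) < 2 * card H1"
  shows "\<exists>u\<in>V1. \<exists>v\<in>V1. near l (f u) (f v) \<and> far (hub u) (hub v)"
proof (rule ccontr)
  assume neg: "\<not> ?thesis"
  have finV1: "finite V1" using V1 finite_leaves finite_subset by blast
  have finH1: "finite H1" using H1(1) finite_H finite_subset by blast
  have close: "v \<in> reach E R u" if uv: "u \<in> V1" "v \<in> V1" and "near l (f u) (f v)" for u v
  proof -
    have "\<not> far (hub u) (hub v)" using neg that by blast
    then obtain \<omega> d b where d: "walk E len \<omega> (hub u) (hub v) d b" "d \<le> 3 * l * q"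
      unfolding far_def not_less[symmetric] by blast
    have spoke: "(hub x, x) \<in> E \<and> len (hub x, x) = l" if "x \<in> V1" for x
      using that V1 len_spoke[of "(hub x, x)"] by (auto simp: spokes_def)
    have "walk E len \<omega> u (hub u) l (\<omega> (hub u, u))" "walk E len \<omega> (hub v) v l (\<omega> (hub v, v))"
      using walk_edge_rev[of "hub u" u E len \<omega>] walk_edge[of "hub v" v E len \<omega>] spoke uv by auto
    note walk_trans[OF this(2) walk_trans[OF d(1) this(1)]]
    then show ?thesis by (rule reach_walk) (use d(2) in \<open>simp add: R_def\<close>)
  qed
  let ?rep = "inv_into V1 f"
  have rep: "?rep c \<in> V1" "f (?rep c) = c" if "c \<in> f ` V1" for c
    using that by (auto intro: inv_into_into f_inv_into_f)
  have near_refl: "near j c c" for j c by (induction j) (auto intro: near0 nearSuc)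
  define adj where "adj c c' \<longleftrightarrow> (\<exists>(u, v)\<in>H1. (f u = c \<and> f v = c') \<or> (f u = c' \<and> f v = c))" for c c'
  have "\<exists>Y \<subseteq> f ` V1 \<times> f ` V1. card Y \<le> 2 ^ w * card (f ` V1) \<and> (\<forall>(r, c)\<in>Y. near l r c) \<and>
      (\<forall>c\<in>f ` V1. \<forall>c'\<in>f ` V1. c = c' \<or> adj c c' \<longrightarrow> (\<exists>r. (r, c) \<in> Y \<and> (r, c') \<in> Y))"
  proof (rule sparse_cover)
    show "near 0 c c" for c by (rule near0)
    show "near (Suc j) r c'" if "near j r c" "c = c' \<or> adj c c'" for j r c c'
      using that nearSuc unfolding adj_def by blast
    show "adj c' c" if "adj c c'" for c c' using that unfolding adj_def by blast
    show "finite (f ` V1)" using finV1 by simp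
    fix r assume r: "r \<in> f ` V1"
    \<comment> \<open>By \<open>close\<close>, representatives of the contracted vertices near
      \<open>r\<close> lie in one ball of radius \<open>R\<close> in the net. This permits the
      growth factor \<open>2 ^ w\<close> with radius \<open>l\<close>.\<close>
    have "card {c \<in> f ` V1. near l r c} \<le> card (reach E R (?rep r))"
    proof (rule card_inj_on_le)
      show "inj_on ?rep {c \<in> f ` V1. near l r c}"
        using inj_on_inv_into[of "{c \<in> f ` V1. near l r c}" f V1] by auto
      show "?rep ` {c \<in> f ` V1. near l r c} \<subseteq> reach E R (?rep r)"
        using close rep r by auto
      show "finite (reach E R (?rep r))" using card_reach[OF H_links degree] by blast
    qed
    also have "\<dots> \<le> 16 ^ R" using card_reach[OF H_links degree] by blast
    also have "(16::nat) ^ R = 2 ^ (4 * R)" by (simp add: power_mult)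
    also have "\<dots> < 2 ^ (w * l)"
    proof (rule power_strict_increasing)
      have "4 * R \<le> l * (20 * q)" using q_pos by (simp add: R_def algebra_simps)
      also have "\<dots> < l * w" using w_large l_pos by simp
      finally show "4 * R < w * l" by (simp add: mult.commute)
    qed simp
    also have "(2::nat) ^ (w * l) = (2 ^ w) ^ l" by (simp add: power_mult)
    finally show "card {c \<in> f ` V1. near l r c} < (2 ^ w) ^ l" .
  qed
  then obtain Y where Y: "Y \<subseteq> f ` V1 \<times> f ` V1" "card Y \<le> 2 ^ w * card (f ` V1)"
    and Y': "\<forall>(r, c)\<in>Y. near l r c"
      "\<forall>c\<in>f ` V1. \<forall>c'\<in>f ` V1. c = c' \<or> adj c c' \<longrightarrow> (\<exists>r. (r, c) \<in> Y \<and> (r, c') \<in> Y)"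
    by (elim exE conjE) (rule that)
  have Ynear: "near l r c" if "(r, c) \<in> Y" for r c using Y'(1) that by auto
  have Ycov: "\<exists>r. (r, f u) \<in> Y \<and> (r, f v) \<in> Y" if "u \<in> V1" "v \<in> V1" "adj (f u) (f v)" for u v
    using Y'(2) that by simp
  have finY: "finite Y" using Y(1) finV1 by (meson finite_SigmaI finite_imageI finite_subset)
  \<comment> \<open>The code of \<open>A\<close>: for each leaf its parity from the representative
    of its contracted vertex, and for each cover incidence the parity between the two
    representatives.\<close>
  define \<Phi> where "\<Phi> A = ({v\<in>V1. parity (\<lambda>e. e \<in> A) (?rep (f v)) v},
      {p\<in>Y. parity (\<lambda>e. e \<in> A) (?rep (fst p)) (?rep (snd p))})" for A
  have "inj_on \<Phi> (Pow H1)"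
  proof (rule inj_onI)
    \<comment> \<open>Both ends of a link lie in a common piece with centre \<open>r\<close>, where
      the code supplies the four parities of \<open>parity_link\<close>.\<close>
    have decode: "(u, v) \<in> A \<longleftrightarrow>
        ((((r, f u) \<in> snd (\<Phi> A)) \<noteq> (u \<in> fst (\<Phi> A))) \<noteq> (((r, f v) \<in> snd (\<Phi> A)) \<noteq> (v \<in> fst (\<Phi> A))))"
      if A: "A \<in> Pow H1" and uv: "(u, v) \<in> H1" and r: "(r, f u) \<in> Y" "(r, f v) \<in> Y" for A u v r
    proof -
      have V: "u \<in> V1" "v \<in> V1" "r \<in> f ` V1" using H1(2)[OF uv] r Y(1) by auto
      have "\<not> (\<lambda>e. e \<in> A) e" if "e \<in> spokes" for e
        using that A H1(1) H_links hub_less by (fastforce simp: spokes_def links_def leaves_def)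
      moreover have "(u, v) \<in> H" using uv H1(1) by blast
      moreover have "?rep (f x) \<in> reach E R (?rep r)" if "x \<in> V1" "(r, f x) \<in> Y" for x
        using close[of "?rep r" "?rep (f x)"] rep V(3) that Ynear by simp
      moreover have "x \<in> reach E R (?rep (f x))" if "x \<in> V1" for x
        using close[of "?rep (f x)" x] rep[of "f x"] that near_refl by simp
      ultimately have "(u, v) \<in> A \<longleftrightarrow>
          ((parity (\<lambda>e. e \<in> A) (?rep r) (?rep (f u)) \<noteq> parity (\<lambda>e. e \<in> A) (?rep (f u)) u) \<noteq>
          (parity (\<lambda>e. e \<in> A) (?rep r) (?rep (f v)) \<noteq> parity (\<lambda>e. e \<in> A) (?rep (f v)) v))"
        using V r by (intro parity_link) auto
      then show ?thesis using V r by (simp add: \<Phi>_def)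
    qed
    have sub: "A \<subseteq> B" if AB: "A \<in> Pow H1" "B \<in> Pow H1" "\<Phi> A = \<Phi> B" for A B
    proof
      fix e assume "e \<in> A"
      then obtain u v where e: "e = (u, v)" "(u, v) \<in> H1" "(u, v) \<in> A" using AB(1) by (cases e) auto
      have "adj (f u) (f v)" using e(2) by (auto simp: adj_def)
      then obtain r where "(r, f u) \<in> Y" "(r, f v) \<in> Y" using Ycov[of u v] H1(2)[OF e(2)] by auto
      from decode[OF AB(1) e(2) this] decode[OF AB(2) e(2) this] e(1,3) AB(3)
      show "e \<in> B" by simp
    qed
    show "A = B" if "A \<in> Pow H1" "B \<in> Pow H1" "\<Phi> A = \<Phi> B" for A B
      using sub[OF that] sub[OF that(2,1) that(3)[symmetric]] by (rule equalityI)
  qed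
  then have "card (Pow H1) \<le> card (Pow V1 \<times> Pow Y)"
    by (rule card_inj_on_le) (use finV1 finY in \<open>auto simp: \<Phi>_def\<close>)
  also have "card (Pow V1 \<times> Pow Y) = 2 ^ (card V1 + card Y)"
    using finV1 finY by (simp add: card_cartesian_product card_Pow power_add)
  finally have "card H1 \<le> card V1 + card Y" using finH1 by (simp add: card_Pow)
  also have "\<dots> \<le> k * 2 ^ l + 2 ^ w * (k * 2 ^ w)"
  proof (rule add_mono)
    show "card V1 \<le> k * 2 ^ l" using card_mono[OF finite_leaves V1] by (simp add: card_leaves)
    show "card Y \<le> 2 ^ w * (k * 2 ^ w)" using Y(2) few by (meson le_trans mult_le_mono2)
  qed
  finally have "2 * card H1 \<le> 2 * (k * 2 ^ l) + k * (2 * 2 ^ w * 2 ^ w)" by (simp add: algebra_simps)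
  \<comment> \<open>As \<open>l = 3 * w\<close>, there are at most half as many incidences as
    leaves, so the code has at most \<open>3 / 2\<close> bits per leaf, fewer than
    \<open>card H1\<close>.\<close>
  also have "(2::nat) * 2 ^ w * 2 ^ w \<le> 2 ^ w * 2 ^ w * 2 ^ w"
    using w_large self_le_power[of 2 w] by simp
  also have "(2::nat) ^ w * 2 ^ w * 2 ^ w = 2 ^ l" by (simp add: l_eq flip: power_add)
  finally show False using many by simp
qed

end

section \<open>Flows\<close>

text \<open>Routes are flows rather than paths, so that concatenation and reversal become addition
  and negation. The set \<open>{}\<close> is a dummy commodity for \<open>netout\<close>.\<close>

definition unit_flow :: "('v, 'e) graph \<Rightarrow> 'e set \<Rightarrow> ('e \<Rightarrow> real) \<Rightarrow> 'v \<Rightarrow> 'v \<Rightarrow> real \<Rightarrow> ('e \<Rightarrow> real) \<Rightarrow> bool" where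
  "unit_flow C Z len x y c \<phi> \<longleftrightarrow> (\<forall>e. \<phi> e \<noteq> 0 \<longrightarrow> e \<in> edges C - Z) \<and>
     (\<forall>v. netout C (\<lambda>_. \<phi>) ({} :: unit set) v = (if v = x then 1 else 0) - (if v = y then 1 else 0)) \<and>
     (\<Sum>e\<in>edges C. len e * \<bar>\<phi> e\<bar>) \<le> c"

lemma netout_slice: "netout C f p v = netout C (\<lambda>_. f p) ({} :: unit set) v"
  by (simp add: netout_def)

lemma netout_add: "netout C (\<lambda>_ e. \<phi> e + \<psi> e) p v = netout C (\<lambda>_. \<phi>) p v + netout C (\<lambda>_. \<psi>) p v"
  unfolding netout_def sum.distrib[symmetric] by (intro sum.cong) auto

lemma netout_minus: "netout C (\<lambda>_ e. - \<phi> e) p v = - netout C (\<lambda>_. \<phi>) p v"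
  unfolding netout_def sum_negf[symmetric] by (intro sum.cong) auto

lemma unit_flow_refl: "0 \<le> c \<Longrightarrow> unit_flow C Z len x x c (\<lambda>_. 0)"
  by (simp add: unit_flow_def netout_def)

lemma unit_flow_trans:
  assumes "unit_flow C Z len x y c \<phi>" "unit_flow C Z len y z d \<psi>" "\<And>e. 0 \<le> len e"
  shows "unit_flow C Z len x z (c + d) (\<lambda>e. \<phi> e + \<psi> e)"
proof -
  have "(\<Sum>e\<in>edges C. len e * \<bar>\<phi> e + \<psi> e\<bar>) \<le> (\<Sum>e\<in>edges C. len e * \<bar>\<phi> e\<bar> + len e * \<bar>\<psi> e\<bar>)"
    using assms(3) by (intro sum_mono) (simp add: mult_left_mono flip: distrib_left)
  also have "\<dots> \<le> c + d" using assms(1,2) by (simp add: unit_flow_def sum.distrib)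
  finally have "(\<Sum>e\<in>edges C. len e * \<bar>\<phi> e + \<psi> e\<bar>) \<le> c + d" .
  moreover have "\<phi> e \<noteq> 0 \<or> \<psi> e \<noteq> 0" if "\<phi> e + \<psi> e \<noteq> 0" for e using that by auto
  ultimately show ?thesis using assms(1,2)
    unfolding unit_flow_def netout_add by fastforce
qed

lemma unit_flow_sym: "unit_flow C Z len x y c \<phi> \<Longrightarrow> unit_flow C Z len y x c (\<lambda>e. - \<phi> e)"
  by (auto simp: unit_flow_def netout_minus)

lemma unit_flow_edge:
  assumes "finite (edges C)" "e \<in> edges C - Z"
  shows "unit_flow C Z len (fst (ends C e)) (snd (ends C e)) (len e) (\<lambda>e'. if e' = e then 1 else 0)"
proof -
  have "netout C (\<lambda>_ e'. if e' = e then 1 else 0) ({} :: unit set) v =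
      (\<Sum>e'\<in>edges C. if e' = e then (if fst (ends C e) = v then 1 else 0) - (if snd (ends C e) = v then 1 else 0) else 0)" for v
    unfolding netout_def by (intro sum.cong) auto
  moreover have "(\<Sum>e'\<in>edges C. len e' * \<bar>if e' = e then 1 else 0\<bar>) = (\<Sum>e'\<in>edges C. if e' = e then len e else 0)"
    by (intro sum.cong) auto
  ultimately show ?thesis using assms by (auto simp: unit_flow_def)
qed

section \<open>The net as a capacitated graph and its contractions\<close>

context sparse_net
begin

text \<open>An edge is named by the code of its pair of endpoints. All edges have the same product of capacity
  and length.\<close>
definition net :: "(nat, nat) graph" where
  "net = \<lparr>verts = {..<k} \<union> leaves, edges = prod_encode ` E, ends = prod_decode,
     cap = (\<lambda>e. if fst (prod_decode e) < k then 6 * real l else 6 * (real l)\<^sup>2)\<rparr>"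

definition elen :: "nat \<Rightarrow> real" where "elen e = real (len (prod_decode e))"

lemma net_simps [simp]: "verts net = {..<k} \<union> leaves" "edges net = prod_encode ` E"
  "ends net = prod_decode" by (simp_all add: net_def)

lemma finite_E: "finite E" using finite_H by simp

lemma elen_nonneg: "0 \<le> elen e" by (simp add: elen_def)

lemma elen_ge_1: "1 \<le> elen e" using l_pos by (simp add: elen_def len_def)

lemma cap_elen: "cap net e * elen e = 6 * (real l)\<^sup>2"
  by (simp add: net_def elen_def len_def power2_eq_square)

text \<open>Leaves room for a whole route: at cost \<open>3 * l\<close> and lengths at least 1, a
  unit flow loads each edge with at most half of its capacity.\<close>

lemma cap_ge: "6 * real l \<le> cap net e"
  using l_pos self_le_power[of "real l" 2] by (auto simp: net_def)

lemma wf_net: "wf_graph net"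
proof -
  have "fst e \<in> verts net \<and> snd e \<in> verts net \<and> fst e \<noteq> snd e" if "e \<in> E" for e
    using that
  proof
    assume "e \<in> spokes"
    then obtain v where "e = (hub v, v)" "v \<in> leaves" by (auto simp: spokes_def)
    moreover from this have "hub v < k" "k \<le> v" using hub_less by (auto simp: leaves_def)
    ultimately show ?thesis by auto
  next
    assume "e \<in> H"
    then have "e \<in> links" using H_links by blast
    then show ?thesis by (auto simp: links_def)
  qed
  moreover have "1 \<le> cap net e" for e using cap_ge[of e] l_pos by linarith
  ultimately show ?thesis using finite_E by (auto simp: wf_graph_def)
qed

lemma cvert_terminal:
  assumes F: "valid_partition net {..<k} F" and t: "t < k"
  shows "cvert {..<k} F t = Inl t"
proof -
  have "t \<in> \<Union>F" using F t by (auto simp: valid_partition_def)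
  then obtain A where A: "A \<in> F" "t \<in> A" by blast
  have "B = A" if "B \<in> F" "t \<in> B" for B
  proof -
    have "\<forall>A\<in>F. \<forall>B\<in>F. A \<noteq> B \<longrightarrow> A \<inter> B = {}" using F by (simp add: valid_partition_def)
    then show ?thesis using A that by blast
  qed
  then have part: "part_of F t = A"
    unfolding part_of_def using A by (intro the_equality) blast+
  have "card (A \<inter> {..<k}) \<le> 1" using F A by (simp add: valid_partition_def)
  then have "t' = t" if "t' < k" "t' \<in> A" for t'
    using that A t card_le_Suc0_iff_eq[of "A \<inter> {..<k}"] by auto
  then have "(THE t'. t' \<in> {..<k} \<and> t' \<in> A) = t" using A t by (intro the_equality) blast+
  moreover have "\<exists>t'\<in>{..<k}. t' \<in> A" using A t by blast
  ultimately show ?thesis by (simp add: cvert_def part)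
qed

lemma contract_simps [simp]:
  "edges (contract net {..<k} F) = {e \<in> prod_encode ` E. part_of F (fst (prod_decode e)) \<noteq> part_of F (snd (prod_decode e))}"
  "ends (contract net {..<k} F) e = (cvert {..<k} F (fst (prod_decode e)), cvert {..<k} F (snd (prod_decode e)))"
  "cap (contract net {..<k} F) = cap net"
  by (simp_all add: contract_def)

lemma finite_contract_edges: "finite (edges (contract net {..<k} F))" using finite_E by simp

text \<open>An edge inside a part vanishes, but then its ends coincide and the zero flow
  serves.\<close>

lemma contract_edge_flow:
  assumes "(x, y) \<in> E" "prod_encode (x, y) \<notin> Z"
  shows "\<exists>\<phi>. unit_flow (contract net {..<k} F) Z elen (cvert {..<k} F x) (cvert {..<k} F y) (len (x, y)) \<phi>"
proof (cases "part_of F x = part_of F y")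
  case True
  then have "cvert {..<k} F x = cvert {..<k} F y" by (simp add: cvert_def)
  then show ?thesis by (intro exI[of _ "\<lambda>_. 0"]) (simp add: unit_flow_refl)
next
  case False
  then show ?thesis
    using unit_flow_edge[OF finite_contract_edges, of "prod_encode (x, y)" F Z elen] assms
    by (auto simp: elen_def)
qed

text \<open>\<open>shortcut\<close> is applied to the leaves whose spokes avoid \<open>Z\<close> and
  the links that survive between them; spokes at both ends extend the route of length
  \<open>l\<close> to the hubs.\<close>

lemma contracted_shortcut:
  assumes F: "valid_partition net {..<k} F" and size: "card (verts (contract net {..<k} F)) \<le> k * 2 ^ w"
    and Z: "finite Z" "32 * card Z \<le> k * 2 ^ l"
  shows "\<exists>t<k. \<exists>t'<k. far t t' \<and>
     (\<exists>\<phi>. unit_flow (contract net {..<k} F) Z elen (Inl t) (Inl t') (3 * real l) \<phi>)"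
proof -
  let ?C = "contract net {..<k} F" and ?f = "cvert {..<k} F"
  define V1 where "V1 = {v\<in>leaves. prod_encode (hub v, v) \<notin> Z}"
  define H1 where "H1 = {(u, v)\<in>H. u \<in> V1 \<and> v \<in> V1 \<and> prod_encode (u, v) \<notin> Z}"
  define near where "near j c c' \<longleftrightarrow> (\<exists>\<phi>. unit_flow ?C Z elen c c' (real j) \<phi>)" for j :: nat and c c'
  have near_trans: "near (i + j) x z" if xyz: "near i x y" "near j y z" for i j x y z
  proof -
    obtain \<phi> \<psi> where "unit_flow ?C Z elen x y (real i) \<phi>" "unit_flow ?C Z elen y z (real j) \<psi>"
      using xyz unfolding near_def by auto
    from unit_flow_trans[OF this elen_nonneg] show ?thesis unfolding near_def by auto
  qed
  have near_sym: "near j y x" if "near j x y" for j x y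
    using that unfolding near_def by (auto dest: unit_flow_sym)
  have near_edge: "near (len (x, y)) (?f x) (?f y)" if "(x, y) \<in> E" "prod_encode (x, y) \<notin> Z" for x y
    unfolding near_def using contract_edge_flow[OF that] .
  have near_link: "near 1 (?f u) (?f v)" if "(u, v) \<in> H1" for u v
    using near_edge[of u v] that H_links len_link[of "(u, v)"] by (auto simp: H1_def)
  have "\<exists>u\<in>V1. \<exists>v\<in>V1. near l (?f u) (?f v) \<and> far (hub u) (hub v)"
  proof (rule shortcut)
    show "V1 \<subseteq> leaves" by (auto simp: V1_def)
    show "H1 \<subseteq> H" by (auto simp: H1_def)
    show "u \<in> V1 \<and> v \<in> V1" if "(u, v) \<in> H1" for u v using that by (auto simp: H1_def)
    have near_refl: "near j c c" for j c
      unfolding near_def by (intro exI[of _ "\<lambda>_. 0"]) (simp add: unit_flow_refl)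
    then show "near 0 c c" for c .
    have "near 1 c c" for c by (rule near_refl)
    then show "near (Suc j) r c" if "near j r c" for j r c using near_trans[OF that, of 1 c] by simp
    show "near (Suc j) r (?f v)" if "(u, v) \<in> H1" "near j r (?f u)" for j r u v
      using near_trans[OF that(2) near_link[OF that(1)]] by simp
    show "near (Suc j) r (?f u)" if "(u, v) \<in> H1" "near j r (?f v)" for j r u v
      using near_trans[OF that(2) near_sym[OF near_link[OF that(1)]]] by simp
    have "?f ` V1 \<subseteq> verts ?C" by (auto simp: contract_def V1_def)
    moreover have "finite (verts ?C)" by (simp add: contract_def)
    ultimately show "card (?f ` V1) \<le> k * 2 ^ w" using size card_mono le_trans by blast
    have "H - H1 \<subseteq> prod_decode ` Z \<union> (\<Union>v\<in>leaves - V1. incident H v)"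
    proof
      fix e assume e: "e \<in> H - H1"
      obtain u v where uv: "e = (u, v)" by (cases e)
      then have "u \<in> leaves" "v \<in> leaves" using e H_links by (auto simp: links_def)
      moreover have "e \<in> incident H u" "e \<in> incident H v" using e uv by (auto simp: incident_def)
      moreover have "e \<in> prod_decode ` Z" if "prod_encode (u, v) \<in> Z"
        using that uv prod_encode_inverse by (metis image_eqI)
      ultimately show "e \<in> prod_decode ` Z \<union> (\<Union>v\<in>leaves - V1. incident H v)"
        using e uv by (auto simp: H1_def)
    qed
    moreover have "finite (incident H v)" for v using finite_H by (simp add: incident_def)
    ultimately have "card (H - H1) \<le> card (prod_decode ` Z \<union> (\<Union>v\<in>leaves - V1. incident H v))"
      using Z by (intro card_mono) auto
    also have "\<dots> \<le> card (prod_decode ` Z) + card (\<Union>v\<in>leaves - V1. incident H v)" by (rule card_Un_le)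
    also have "\<dots> \<le> card Z + (\<Sum>v\<in>leaves - V1. card (incident H v))"
      using Z by (intro add_mono card_image_le card_UN_le) auto
    also have "\<dots> \<le> card Z + card (leaves - V1) * 4"
      using sum_bounded_above[of "leaves - V1" "\<lambda>v. card (incident H v)" 4] degree by simp
    also have "card (leaves - V1) \<le> card Z"
    proof (rule card_inj_on_le[of "\<lambda>v. prod_encode (hub v, v)"])
      show "inj_on (\<lambda>v. prod_encode (hub v, v)) (leaves - V1)" by (auto intro!: inj_onI)
    qed (use Z in \<open>auto simp: V1_def\<close>)
    \<comment> \<open>A deleted link costs itself, a deleted spoke the at most 4 links at its leaf.
      With \<open>card Z\<close> at most \<open>n / 32\<close>, at least
      \<open>15 / 8 * n - 5 / 32 * n\<close> links remain, more than
      \<open>3 / 2 * n\<close>.\<close>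
    finally have "card (H - H1) \<le> 5 * card Z" by simp
    moreover have "card H = card H1 + card (H - H1)"
    proof -
      have "H1 \<subseteq> H" by (auto simp: H1_def)
      then show ?thesis
        using card_Diff_subset[of H1 H] card_mono[OF finite_H] finite_subset[OF _ finite_H] by simp
    qed
    moreover have "0 < k * 2 ^ l" using k_pos by simp
    ultimately show "3 * (k * 2 ^ l) < 2 * card H1" using H_large Z(2) by linarith
  qed
  then obtain u v where uv: "u \<in> V1" "v \<in> V1" "near l (?f u) (?f v)" "far (hub u) (hub v)" by blast
  have spoke: "near l (Inl (hub x)) (?f x)" "hub x < k" if "x \<in> V1" for x
  proof -
    have "(hub x, x) \<in> spokes" "hub x < k" using that hub_less by (auto simp: V1_def spokes_def)
    then show "near l (Inl (hub x)) (?f x)" "hub x < k"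
      using near_edge[of "hub x" x] cvert_terminal[OF F, of "hub x"] len_spoke[of "(hub x, x)"] that
      by (auto simp: V1_def)
  qed
  have "near (l + (l + l)) (Inl (hub u)) (Inl (hub v))"
    using near_trans[OF spoke(1)[OF uv(1)] near_trans[OF uv(3) near_sym[OF spoke(1)[OF uv(2)]]]] .
  moreover have "real (l + (l + l)) = 3 * real l" by simp
  ultimately show ?thesis using uv spoke(2) unfolding near_def by metis
qed

section \<open>Packings of short routes between far terminals\<close>

lemma far_sym: "far t t' \<Longrightarrow> far t' t"
  unfolding far_def using walk_sym by blast

lemma finite_term_pairs: "finite (term_pairs {..<k})"
  by (rule finite_subset[of _ "Pow {..<k}"]) (auto simp: term_pairs_def)

lemma term_pair_Min_Max:
  assumes "p \<in> term_pairs {..<k}"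
  shows "Min p < k" "Max p < k" "Min p < Max p" "p = {Min p, Max p}"
proof -
  obtain a b where ab: "a < k" "b < k" "a \<noteq> b" "p = {a, b}"
    using assms by (auto simp: term_pairs_def)
  then have "a < b \<or> b < a" by auto
  then show "Min p < k" "Max p < k" "Min p < Max p" "p = {Min p, Max p}"
    using ab by (auto simp: insert_commute)
qed

text \<open>Each commodity runs from \<open>Min p\<close> to \<open>Max p\<close> with average route
  length at most \<open>3 * l\<close>. Conservation is required at all values of the vertex type,
  which eases the transfer to the copies in \<open>Hmu\<close>.\<close>

definition short_flow ::
  "nat set set \<Rightarrow> (nat set \<Rightarrow> real) \<Rightarrow> (nat set \<Rightarrow> nat \<Rightarrow> real) \<Rightarrow> bool" where
  "short_flow F D f \<longleftrightarrow> (\<forall>p\<in>term_pairs {..<k}. 0 \<le> D p \<and> (D p \<noteq> 0 \<longrightarrow> far (Min p) (Max p)) \<and>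
      (\<forall>v. netout (contract net {..<k} F) f p v =
        D p * ((if v = Inl (Min p) then 1 else 0) - (if v = Inl (Max p) then 1 else 0))) \<and>
      (\<Sum>e\<in>edges (contract net {..<k} F). elen e * \<bar>f p e\<bar>) \<le> 3 * real l * D p) \<and>
    (\<forall>e\<in>edges (contract net {..<k} F). (\<Sum>p\<in>term_pairs {..<k}. \<bar>f p e\<bar>) \<le> cap net e)"

lemma abs_netout_le: "\<bar>netout C f p v\<bar> \<le> (\<Sum>e\<in>edges C. \<bar>f p e\<bar>)"
  unfolding netout_def by (rule order.trans[OF sum_abs]) (auto intro!: sum_mono)

text \<open>Guarantees that a largest packing exists: each unit of demand must leave its source over
  some edge.\<close>

lemma short_flow_bound:
  assumes "short_flow F D f"
  shows "(\<Sum>p\<in>term_pairs {..<k}. D p) \<le> (\<Sum>e\<in>edges (contract net {..<k} F). cap net e)"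
proof -
  let ?C = "contract net {..<k} F"
  have "D p \<le> (\<Sum>e\<in>edges ?C. \<bar>f p e\<bar>)" if "p \<in> term_pairs {..<k}" for p
  proof -
    have "netout ?C f p (Inl (Min p)) = D p"
      using assms that term_pair_Min_Max(3)[OF that] unfolding short_flow_def by auto
    then show ?thesis using abs_netout_le[of ?C f p "Inl (Min p)"] by linarith
  qed
  then have "(\<Sum>p\<in>term_pairs {..<k}. D p) \<le> (\<Sum>p\<in>term_pairs {..<k}. \<Sum>e\<in>edges ?C. \<bar>f p e\<bar>)"
    by (rule sum_mono)
  also have "\<dots> = (\<Sum>e\<in>edges ?C. \<Sum>p\<in>term_pairs {..<k}. \<bar>f p e\<bar>)" by (rule sum.swap)
  also have "\<dots> \<le> (\<Sum>e\<in>edges ?C. cap net e)"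
    using assms unfolding short_flow_def by (intro sum_mono) blast
  finally show ?thesis .
qed

text \<open>The new route avoids edges loaded beyond half of their capacity and, by
  \<open>cap_ge\<close>, adds at most half elsewhere.\<close>

lemma short_flow_extend:
  assumes sf: "short_flow F D f" and t: "t < k" "t' < k" "far t t'" "t < t'"
    and \<phi>: "unit_flow (contract net {..<k} F) {e. (\<Sum>p\<in>term_pairs {..<k}. \<bar>f p e\<bar>) > cap net e / 2} elen
      (Inl t) (Inl t') (3 * real l) \<phi>"
  shows "\<exists>D' f'. short_flow F D' f' \<and>
      (\<Sum>p\<in>term_pairs {..<k}. D' p) = (\<Sum>p\<in>term_pairs {..<k}. D p) + 1"
proof -
  let ?C = "contract net {..<k} F" and ?P = "term_pairs {..<k}"
  define p0 where "p0 = {t, t'}"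
  have p0: "p0 \<in> ?P" "Min p0 = t" "Max p0 = t'"
  proof -
    show "p0 \<in> ?P" unfolding term_pairs_def p0_def
      by (intro CollectI exI[of _ t] exI[of _ t']) (use t in simp)
    show "Min p0 = t" "Max p0 = t'" using t by (auto simp: p0_def)
  qed
  define f' where "f' = f(p0 := (\<lambda>e. f p0 e + \<phi> e))"
  define D' where "D' = D(p0 := D p0 + 1)"
  have f'_p0: "f' p0 = (\<lambda>e. f p0 e + \<phi> e)" and f'_other: "\<And>p. p \<noteq> p0 \<Longrightarrow> f' p = f p"
    by (simp_all add: f'_def)
  have net': "netout ?C f' p v = netout ?C f p v" if "p \<noteq> p0" for p v
    unfolding netout_slice[of ?C f' p v] netout_slice[of ?C f p v] f'_other[OF that] ..
  have "netout ?C f' p0 v = netout ?C f p0 v + netout ?C (\<lambda>_. \<phi>) ({} :: unit set) v" for v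
    unfolding netout_slice[of ?C f' p0 v] netout_slice[of ?C f p0 v] f'_p0 netout_add ..
  moreover have "netout ?C f p0 v = D p0 * ((if v = Inl t then 1 else 0) - (if v = Inl t' then 1 else 0))" for v
    using sf p0 by (simp add: short_flow_def)
  moreover have "netout ?C (\<lambda>_. \<phi>) ({} :: unit set) v = (if v = Inl t then 1 else 0) - (if v = Inl t' then 1 else 0)" for v
    using \<phi> by (simp add: unit_flow_def)
  ultimately have net0: "netout ?C f' p0 v = (D p0 + 1) * ((if v = Inl t then 1 else 0) - (if v = Inl t' then 1 else 0))" for v
    by (simp add: algebra_simps)
  have "(\<Sum>e\<in>edges ?C. elen e * \<bar>f' p0 e\<bar>) \<le> (\<Sum>e\<in>edges ?C. elen e * \<bar>f p0 e\<bar> + elen e * \<bar>\<phi> e\<bar>)"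
    using elen_nonneg by (intro sum_mono) (simp add: f'_def mult_left_mono flip: distrib_left)
  also have "\<dots> \<le> 3 * real l * D p0 + 3 * real l"
    using sf p0(1) \<phi> by (auto simp: short_flow_def unit_flow_def sum.distrib intro!: add_mono)
  finally have cost0: "(\<Sum>e\<in>edges ?C. elen e * \<bar>f' p0 e\<bar>) \<le> 3 * real l * (D p0 + 1)"
    by (simp add: algebra_simps)
  have cap': "(\<Sum>p\<in>?P. \<bar>f' p e\<bar>) \<le> cap net e" if e: "e \<in> edges ?C" for e
  proof (cases "\<phi> e = 0")
    case True
    then have "(\<Sum>p\<in>?P. \<bar>f' p e\<bar>) = (\<Sum>p\<in>?P. \<bar>f p e\<bar>)" by (intro sum.cong) (auto simp: f'_def)
    then show ?thesis using sf e by (auto simp: short_flow_def)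
  next
    case False
    then have half: "(\<Sum>p\<in>?P. \<bar>f p e\<bar>) \<le> cap net e / 2" using \<phi> by (force simp: unit_flow_def)
    have "elen e * \<bar>\<phi> e\<bar> \<le> (\<Sum>e\<in>edges ?C. elen e * \<bar>\<phi> e\<bar>)"
      using e finite_contract_edges elen_nonneg by (intro member_le_sum) auto
    then have "elen e * \<bar>\<phi> e\<bar> \<le> 3 * real l" using \<phi> by (auto simp: unit_flow_def)
    moreover have "\<bar>\<phi> e\<bar> \<le> elen e * \<bar>\<phi> e\<bar>" using mult_right_mono[OF elen_ge_1, of "\<bar>\<phi> e\<bar>"] by simp
    ultimately have "\<bar>\<phi> e\<bar> \<le> cap net e / 2" using cap_ge[of e] by linarith
    moreover have "(\<Sum>p\<in>?P. \<bar>f' p e\<bar>) \<le> (\<Sum>p\<in>?P. \<bar>f p e\<bar> + (if p = p0 then \<bar>\<phi> e\<bar> else 0))"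
      by (intro sum_mono) (auto simp: f'_def)
    moreover have "\<dots> = (\<Sum>p\<in>?P. \<bar>f p e\<bar>) + \<bar>\<phi> e\<bar>"
      using p0(1) finite_term_pairs by (simp add: sum.distrib)
    ultimately show ?thesis using half by linarith
  qed
  have "short_flow F D' f'"
    unfolding short_flow_def
  proof (intro conjI ballI)
    fix p assume p: "p \<in> ?P"
    show "0 \<le> D' p" using sf p by (auto simp: short_flow_def D'_def)
    show "D' p \<noteq> 0 \<longrightarrow> far (Min p) (Max p)" using sf p p0 t by (auto simp: short_flow_def D'_def)
    show "\<forall>v. netout ?C f' p v = D' p * ((if v = Inl (Min p) then 1 else 0) - (if v = Inl (Max p) then 1 else 0))"
    proof (cases "p = p0")
      case True
      then show ?thesis using net0 p0 by (simp add: D'_def)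
    next
      case False
      then show ?thesis using net' sf p by (simp add: D'_def short_flow_def)
    qed
    show "(\<Sum>e\<in>edges ?C. elen e * \<bar>f' p e\<bar>) \<le> 3 * real l * D' p"
    proof (cases "p = p0")
      case True
      then show ?thesis using cost0 by (simp add: D'_def)
    next
      case False
      then show ?thesis using sf p by (simp add: D'_def f'_def short_flow_def)
    qed
  qed (rule cap')
  moreover have "(\<Sum>p\<in>?P. D' p) = (\<Sum>p\<in>?P. D p + (if p = p0 then 1 else 0))"
    by (intro sum.cong) (auto simp: D'_def)
  then have "(\<Sum>p\<in>?P. D' p) = (\<Sum>p\<in>?P. D p) + 1"
    using p0(1) finite_term_pairs by (simp add: sum.distrib)
  ultimately show ?thesis by blast
qed

text \<open>A maximal packing of short routes loads many edges to at least half of their capacity, since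
  otherwise there is a short route avoiding the loaded edges.\<close>
lemma large_short_flow:
  assumes F: "valid_partition net {..<k} F" and size: "card (verts (contract net {..<k} F)) \<le> k * 2 ^ w"
  shows "\<exists>D f. short_flow F D f \<and> real l * real (k * 2 ^ l) \<le> 32 * (\<Sum>p\<in>term_pairs {..<k}. D p)"
proof -
  let ?C = "contract net {..<k} F" and ?P = "term_pairs {..<k}"
  \<comment> \<open>Extensions add exactly one unit, so it suffices to maximise over integral
    totals.\<close>
  define Q where "Q N \<longleftrightarrow> (\<exists>D f. short_flow F D f \<and> (\<Sum>p\<in>?P. D p) = real N)" for N
  have "short_flow F (\<lambda>_. 0) (\<lambda>_ _. 0)"
    using cap_ge l_pos by (auto simp: short_flow_def netout_def intro: order.trans[OF _ cap_ge])
  then have "Q 0" unfolding Q_def by (intro exI[of _ "\<lambda>_. 0"] exI[of _ "\<lambda>_ _. 0"]) simp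
  have bound: "N \<le> nat \<lceil>\<Sum>e\<in>edges ?C. cap net e\<rceil>" if "Q N" for N
  proof -
    obtain D f where "short_flow F D f" "(\<Sum>p\<in>?P. D p) = real N" using \<open>Q N\<close> by (auto simp: Q_def)
    with short_flow_bound[OF this(1)] show ?thesis by linarith
  qed
  obtain N where N: "Q N" and max: "\<And>N'. Q N' \<Longrightarrow> N' \<le> N"
    using Greatest_le_nat[of Q _ "nat \<lceil>\<Sum>e\<in>edges ?C. cap net e\<rceil>"]
      GreatestI_nat[of Q 0 "nat \<lceil>\<Sum>e\<in>edges ?C. cap net e\<rceil>"] bound \<open>Q 0\<close> by blast
  obtain D f where sf: "short_flow F D f" and sum: "(\<Sum>p\<in>?P. D p) = real N" using N by (auto simp: Q_def)
  let ?load = "\<lambda>e. \<Sum>p\<in>?P. \<bar>f p e\<bar>"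
  define Z where "Z = {e. ?load e > cap net e / 2}"
  have no: "\<not> unit_flow ?C Z elen (Inl t) (Inl t') (3 * real l) \<phi>"
    if "t < k" "t' < k" "far t t'" for t t' \<phi>
  proof
    assume u: "unit_flow ?C Z elen (Inl t) (Inl t') (3 * real l) \<phi>"
    have ext: False if "t < k" "t' < k" "far t t'" "t < t'"
      "unit_flow ?C Z elen (Inl t) (Inl t') (3 * real l) \<phi>" for t t' \<phi>
    proof -
      have "Q (Suc N)"
        using short_flow_extend[OF sf that(1-4)] that(5) sum unfolding Z_def Q_def by (simp add: add.commute)
      then show False using max by force
    qed
    \<comment> \<open>The extension expects the smaller terminal first; otherwise the route is
      reversed.\<close>
    have "t \<noteq> t'" using \<open>far t t'\<close> walk.nil unfolding far_def by force
    then show False using ext[OF that] ext[OF that(2,1) far_sym[OF that(3)]] u unit_flow_sym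
      by (meson linorder_neqE_nat)
  qed
  let ?Z = "Z \<inter> edges ?C"
  have finZ: "finite ?Z" using finite_contract_edges by blast
  have "\<not> 32 * card ?Z \<le> k * 2 ^ l"
  proof
    assume "32 * card ?Z \<le> k * 2 ^ l"
    from contracted_shortcut[OF F size finZ this] obtain t t' \<phi>
      where t: "t < k" "t' < k" "far t t'" and "unit_flow ?C ?Z elen (Inl t) (Inl t') (3 * real l) \<phi>" by blast
    then have "unit_flow ?C Z elen (Inl t) (Inl t') (3 * real l) \<phi>" unfolding unit_flow_def by blast
    then show False using no[OF t] by blast
  qed
  then have "real (k * 2 ^ l) \<le> 32 * real (card ?Z)" by linarith
  \<comment> \<open>Comparison of volumes: each edge of \<open>?Z\<close> carries at least
    \<open>cap net e * elen e / 2 = 3 * (real l)\<^sup>2\<close>, while a unit of demand uses at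
    most \<open>3 * l\<close> in total.\<close>
  have "real (card ?Z) * (3 * (real l)\<^sup>2) = (\<Sum>e\<in>?Z. cap net e * elen e / 2)"
    by (simp add: cap_elen)
  also have "\<dots> \<le> (\<Sum>e\<in>?Z. elen e * ?load e)"
  proof (rule sum_mono)
    fix e assume "e \<in> ?Z"
    then have "cap net e / 2 \<le> ?load e" by (simp add: Z_def)
    then show "cap net e * elen e / 2 \<le> elen e * ?load e"
      using mult_left_mono[OF _ elen_nonneg[of e]] by (fastforce simp: mult.commute)
  qed
  also have "\<dots> \<le> (\<Sum>e\<in>edges ?C. elen e * ?load e)"
    using finite_contract_edges elen_nonneg by (intro sum_mono2) (auto intro!: mult_nonneg_nonneg sum_nonneg)
  also have "\<dots> = (\<Sum>p\<in>?P. \<Sum>e\<in>edges ?C. elen e * \<bar>f p e\<bar>)"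
    unfolding sum_distrib_left by (rule sum.swap)
  also have "\<dots> \<le> (\<Sum>p\<in>?P. 3 * real l * D p)"
    using sf unfolding short_flow_def by (intro sum_mono) blast
  also have "\<dots> = 3 * real l * (\<Sum>p\<in>?P. D p)" by (simp add: sum_distrib_left)
  finally have "(3 * real l) * (real l * real (card ?Z)) \<le> (3 * real l) * (\<Sum>p\<in>?P. D p)"
    by (simp add: power2_eq_square mult_ac)
  then have "real l * real (card ?Z) \<le> (\<Sum>p\<in>?P. D p)" using l_pos by simp
  moreover have "real l * real (k * 2 ^ l) \<le> real l * (32 * real (card ?Z))"
    by (rule mult_left_mono[OF \<open>real (k * 2 ^ l) \<le> 32 * real (card ?Z)\<close>]) simp
  ultimately have "real l * real (k * 2 ^ l) \<le> 32 * (\<Sum>p\<in>?P. D p)" by linarith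
  with sf show ?thesis by blast
qed

section \<open>Quality\<close>

text \<open>The distance from \<open>t\<close>, truncated at \<open>3 * l * q\<close>; the
  truncation also gives unreachable vertices a value.\<close>

definition pot :: "nat \<Rightarrow> nat \<Rightarrow> nat" where
  "pot t v = (LEAST j. 3 * l * q \<le> j \<or> v \<in> reach E j t)"

lemma pot_self: "pot t t = 0"
  unfolding pot_def by (rule Least_equality) (auto intro: reach_walk[OF walk.nil])

lemma pot_far:
  assumes "far t t'"
  shows "pot t t' = 3 * l * q"
  unfolding pot_def
proof (rule Least_equality)
  fix j assume "3 * l * q \<le> j \<or> t' \<in> reach E j t"
  then show "3 * l * q \<le> j" using assms unfolding far_def reach_def by fastforce
qed simp

lemma pot_step:
  assumes step: "\<And>\<omega>. \<exists>b. walk E len \<omega> x y d b"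
  shows "pot t y \<le> pot t x + d"
proof -
  have "3 * l * q \<le> pot t x \<or> x \<in> reach E (pot t x) t"
    unfolding pot_def by (rule LeastI[where k = "3 * l * q"]) simp
  then have "3 * l * q \<le> pot t x + d \<or> y \<in> reach E (pot t x + d) t"
  proof
    assume "x \<in> reach E (pot t x) t"
    then obtain d0 b0 where "d0 \<le> pot t x" and w: "walk E len (\<lambda>_. False) t x d0 b0"
      by (auto simp: reach_def)
    moreover obtain b where "walk E len (\<lambda>_. False) x y d b" using step by blast
    ultimately show ?thesis using reach_walk[OF walk_trans[OF _ w]] by simp
  qed simp
  then show ?thesis unfolding pot_def by (rule Least_le)
qed

lemma pot_edge:
  assumes "e \<in> edges net"
  shows "\<bar>real (pot t (fst (ends net e))) - real (pot t (snd (ends net e)))\<bar> \<le> elen e"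
proof -
  obtain x y where xy: "prod_decode e = (x, y)" by (cases "prod_decode e")
  then have E: "(x, y) \<in> E" using assms by auto
  have "pot t y \<le> pot t x + len (x, y)" by (rule pot_step) (rule exI, rule walk_edge[OF E])
  moreover have "pot t x \<le> pot t y + len (x, y)" by (rule pot_step) (rule exI, rule walk_edge_rev[OF E])
  ultimately show ?thesis by (simp add: xy elen_def)
qed

lemma card_edges_net: "card (edges net) \<le> 3 * (k * 2 ^ l)"
proof -
  have "2 * card H \<le> (\<Sum>v\<in>leaves. 4)"
    unfolding sum_card_incident[OF H_links, symmetric] by (rule sum_mono) (rule degree)
  moreover have "card spokes \<le> k * 2 ^ l"
    unfolding spokes_def card_leaves[symmetric] by (rule card_image_le) simp
  moreover have "card (edges net) \<le> card spokes + card H"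
    using card_image_le[OF finite_E, of prod_encode] card_Un_le[of spokes H] by simp
  ultimately show ?thesis by (simp add: card_leaves)
qed

text \<open>Weak duality with the lengths as the dual solution: \<open>pot\<close> is a 1-Lipschitz function that
  separates far terminals.\<close>
lemma congestion_ge:
  assumes routes: "routes net id {..<k} D f"
    and D: "\<And>p. p \<in> term_pairs {..<k} \<Longrightarrow> 0 \<le> D p \<and> (D p \<noteq> 0 \<longrightarrow> far (Min p) (Max p))"
    and cong: "\<And>e. e \<in> edges net \<Longrightarrow> (\<Sum>p\<in>term_pairs {..<k}. \<bar>f p e\<bar>) \<le> c * cap net e"
    and large: "real l * real (k * 2 ^ l) \<le> 32 * (\<Sum>p\<in>term_pairs {..<k}. D p)"
  shows "real q / 192 \<le> c"
proof -
  let ?P = "term_pairs {..<k}"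
  have "D p * real (3 * l * q) \<le> (\<Sum>e\<in>edges net. elen e * \<bar>f p e\<bar>)" if p: "p \<in> ?P" for p
  proof (cases "D p = 0")
    case True
    then show ?thesis using elen_nonneg by (auto intro!: sum_nonneg mult_nonneg_nonneg)
  next
    case False
    define \<pi> where "\<pi> v = real (pot (Min p) v)" for v
    from routes p obtain a b where ab: "a \<in> {..<k}" "b \<in> {..<k}" "p = {a, b}" "a \<noteq> b"
      and net: "\<forall>v\<in>verts net. netout net f p v =
          D p * ((if v = id a then 1 else 0) - (if v = id b then 1 else 0))"
      unfolding routes_def by blast
    have ends: "fst (ends net e) \<in> verts net" "snd (ends net e) \<in> verts net" if "e \<in> edges net" for e
      using wf_net that by (auto simp: wf_graph_def)
    have finv: "finite (verts net)" by simp
    have "far (Min p) (Max p)" using D[OF p] False by blast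
    then have pi: "\<pi> (Min p) = 0" "\<pi> (Max p) = real (3 * l * q)"
      by (simp_all add: \<pi>_def pot_self pot_far)
    have "(\<Sum>v\<in>verts net. netout net f p v * \<pi> v) =
        (\<Sum>v\<in>verts net. (if v = a then D p * \<pi> v else 0) - (if v = b then D p * \<pi> v else 0))"
      using net by (intro sum.cong) auto
    also have "\<dots> = D p * \<pi> a - D p * \<pi> b"
      using ab finv by (subst sum_subtractf) (simp add: sum.delta del: net_simps, auto)
    finally have lhs: "(\<Sum>v\<in>verts net. netout net f p v * \<pi> v) = D p * (\<pi> a - \<pi> b)"
      by (simp add: right_diff_distrib)
    \<comment> \<open>Summation by parts turns conservation at vertices into potential differences
      along edges, which \<open>pot_edge\<close> bounds by the lengths.\<close>
    have "(\<Sum>v\<in>verts net. netout net f p v * \<pi> v) =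
        (\<Sum>v\<in>verts net. \<Sum>e\<in>edges net. (if fst (ends net e) = v then f p e * \<pi> v else 0) -
          (if snd (ends net e) = v then f p e * \<pi> v else 0))"
      unfolding netout_def sum_distrib_right
      by (intro sum.cong) (auto simp: left_diff_distrib)
    also have "\<dots> = (\<Sum>e\<in>edges net. \<Sum>v\<in>verts net. (if fst (ends net e) = v then f p e * \<pi> v else 0) -
          (if snd (ends net e) = v then f p e * \<pi> v else 0))"
      by (rule sum.swap)
    also have "\<dots> = (\<Sum>e\<in>edges net. f p e * (\<pi> (fst (ends net e)) - \<pi> (snd (ends net e))))"
    proof (rule sum.cong[OF refl])
      fix e assume e: "e \<in> edges net"
      show "(\<Sum>v\<in>verts net. (if fst (ends net e) = v then f p e * \<pi> v else 0) -
          (if snd (ends net e) = v then f p e * \<pi> v else 0)) =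
          f p e * (\<pi> (fst (ends net e)) - \<pi> (snd (ends net e)))"
        unfolding sum_subtractf sum.delta'[OF finv] using ends[OF e] by (simp add: right_diff_distrib del: net_simps)
    qed
    finally have "\<bar>D p * (\<pi> a - \<pi> b)\<bar> \<le>
        (\<Sum>e\<in>edges net. \<bar>f p e * (\<pi> (fst (ends net e)) - \<pi> (snd (ends net e)))\<bar>)"
      unfolding lhs using sum_abs by metis
    also have "\<dots> \<le> (\<Sum>e\<in>edges net. elen e * \<bar>f p e\<bar>)"
    proof (rule sum_mono)
      fix e assume e: "e \<in> edges net"
      show "\<bar>f p e * (\<pi> (fst (ends net e)) - \<pi> (snd (ends net e)))\<bar> \<le> elen e * \<bar>f p e\<bar>"
        unfolding abs_mult mult.commute[of "\<bar>f p e\<bar>"] \<pi>_def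
        by (rule mult_right_mono[OF pot_edge[OF e]]) simp
    qed
    finally have "\<bar>D p * (\<pi> a - \<pi> b)\<bar> \<le> (\<Sum>e\<in>edges net. elen e * \<bar>f p e\<bar>)" .
    \<comment> \<open>\<open>routes\<close> may orient the pair either way, hence the absolute
      values.\<close>
    moreover have "\<bar>D p * (\<pi> a - \<pi> b)\<bar> = D p * real (3 * l * q)"
    proof -
      have "(a = Min p \<and> b = Max p) \<or> (a = Max p \<and> b = Min p)"
        using ab by (cases "a < b") auto
      then have "\<bar>\<pi> a - \<pi> b\<bar> = real (3 * l * q)" using pi by auto
      then show ?thesis using D[OF p] by (simp add: abs_mult)
    qed
    ultimately show ?thesis by simp
  qed
  then have "(\<Sum>p\<in>?P. D p * real (3 * l * q)) \<le> (\<Sum>p\<in>?P. \<Sum>e\<in>edges net. elen e * \<bar>f p e\<bar>)"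
    by (rule sum_mono)
  also have "\<dots> = (\<Sum>e\<in>edges net. elen e * (\<Sum>p\<in>?P. \<bar>f p e\<bar>))"
    unfolding sum_distrib_left by (rule sum.swap)
  also have "\<dots> \<le> (\<Sum>e\<in>edges net. elen e * (c * cap net e))"
    using cong elen_nonneg by (intro sum_mono mult_left_mono) auto
  also have "\<dots> = (\<Sum>e\<in>edges net. c * (6 * (real l)\<^sup>2))"
    using cap_elen by (intro sum.cong refl) (metis mult.commute mult.left_commute)
  also have "\<dots> = c * (6 * (real l)\<^sup>2) * card (edges net)" by simp
  finally have up: "(\<Sum>p\<in>?P. D p) * real (3 * l * q) \<le> c * (6 * (real l)\<^sup>2) * card (edges net)"
    by (simp only: sum_distrib_right)
  define n where "n = real (k * 2 ^ l)"
  have n: "0 < n" using k_pos by (simp add: n_def)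
  have "real l * n * real (3 * l * q) \<le> 32 * ((\<Sum>p\<in>?P. D p) * real (3 * l * q))"
    using mult_right_mono[OF large, of "real (3 * l * q)"] by (simp add: n_def mult.assoc)
  with up have main: "real l * n * real (3 * l * q) \<le> 32 * (c * (6 * (real l)\<^sup>2) * card (edges net))"
    by linarith
  moreover have "0 < real l * n * real (3 * l * q)" using n l_pos q_pos by simp
  ultimately have "0 < c * ((6 * (real l)\<^sup>2) * card (edges net))" by (simp only: mult.assoc)
  then have "0 < c" using zero_less_mult_pos2[of c "(6 * (real l)\<^sup>2) * card (edges net)"]
    by (smt (verit) mult_nonpos_nonneg of_nat_0_le_iff zero_le_mult_iff zero_le_power2)
  have "real (card (edges net)) \<le> 3 * n" using card_edges_net unfolding n_def by linarith
  then have "c * (6 * (real l)\<^sup>2) * card (edges net) \<le> c * (6 * (real l)\<^sup>2) * (3 * n)"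
    using \<open>0 < c\<close> by (intro mult_left_mono) auto
  \<comment> \<open>The volume available is at most \<open>18 * l ^ 2 * n * c\<close>, and the
    demand of at least \<open>l * n / 32\<close> needs \<open>3 * l * q\<close> per unit:
    \<open>32 * 18 / 3 = 192\<close>.\<close>
  with main have "(3 * (real l)\<^sup>2 * n) * real q \<le> (3 * (real l)\<^sup>2 * n) * (192 * c)"
    by (simp add: power2_eq_square mult_ac)
  moreover have "0 < 3 * (real l)\<^sup>2 * n" using n l_pos by simp
  ultimately have "real q \<le> 192 * c" by (simp only: mult_le_cancel_left_pos)
  then show ?thesis by simp
qed

section \<open>Averaging over a convex combination\<close>

lemma tag_eq_Inl: "tag F x = Inl t \<longleftrightarrow> x = Inl t"
  by (auto simp: tag_def split: sum.splits)

lemma inj_tag: "tag F x = tag F y \<longleftrightarrow> x = y"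
  by (auto simp: tag_def split: sum.splits)

text \<open>The demands packed in the single contracted graphs are averaged with weights
  \<open>pmf mu F\<close>. The scaled copies route the average with congestion 1, whereas it still
  has large total and joins only far terminals, so \<open>congestion_ge\<close> applies in the
  net.\<close>

lemma quality_net:
  assumes size: "conv_comb_size net {..<k} mu s" "s \<le> real (k * 2 ^ w)"
  shows "quality_at_least net {..<k} mu (real q / 192)"
  unfolding quality_at_least_def
proof (intro allI impI)
  fix q' assume sp: "flow_sparsifier net {..<k} (Hmu net {..<k} mu) Inl q'"
  let ?P = "term_pairs {..<k}" and ?C = "\<lambda>F. contract net {..<k} F" and ?H = "Hmu net {..<k} mu"
  let ?S = "set_pmf mu"
  have valid: "valid_partition net {..<k} F" "card (verts (?C F)) \<le> k * 2 ^ w" if "F \<in> ?S" for F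
  proof -
    show "valid_partition net {..<k} F" using size(1) that by (simp add: conv_comb_size_def)
    have "real (card (verts (?C F))) \<le> real (k * 2 ^ w)"
      using size that unfolding conv_comb_size_def by (meson order.trans)
    then show "card (verts (?C F)) \<le> k * 2 ^ w" by linarith
  qed
  have "?S \<subseteq> Pow (Pow (verts net))" 
  proof
    fix F assume "F \<in> ?S"
    then have "\<Union>F = verts net" using valid(1) by (simp add: valid_partition_def)
    then show "F \<in> Pow (Pow (verts net))" by blast
  qed
  then have finS: "finite ?S" by (rule finite_subset) simp
  define good where "good F X \<longleftrightarrow> short_flow F (fst X) (snd X) \<and>
      real l * real (k * 2 ^ l) \<le> 32 * (\<Sum>p\<in>?P. fst X p)" for F X
  define DF where "DF F = fst (SOME X. good F X)" for F
  define fF where "fF F = snd (SOME X. good F X)" for F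
  have "good F (DF F, fF F)" if F: "F \<in> ?S" for F
  proof -
    obtain D f where "good F (D, f)"
      using large_short_flow[OF valid[OF F]] unfolding good_def by auto
    then have "good F (SOME X. good F X)" by (rule someI)
    then show ?thesis by (simp add: DF_def fF_def)
  qed
  then have sf: "short_flow F (DF F) (fF F)"
    and big: "real l * real (k * 2 ^ l) \<le> 32 * (\<Sum>p\<in>?P. DF F p)" if "F \<in> ?S" for F
    using that by (auto simp: good_def)
  define D where "D p = (\<Sum>F\<in>?S. pmf mu F * DF F p)" for p
  define f where "f p = (\<lambda>(F, e). pmf mu F * fF F p e)" for p
  have D: "0 \<le> D p \<and> (D p \<noteq> 0 \<longrightarrow> far (Min p) (Max p))" if "p \<in> ?P" for p
  proof
    show "0 \<le> D p" using sf that unfolding D_def short_flow_def by (intro sum_nonneg mult_nonneg_nonneg) auto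
    show "D p \<noteq> 0 \<longrightarrow> far (Min p) (Max p)"
    proof
      assume "D p \<noteq> 0"
      then obtain F where "F \<in> ?S" "pmf mu F * DF F p \<noteq> 0"
        unfolding D_def by (rule sum.not_neutral_contains_not_neutral)
      then show "far (Min p) (Max p)" using sf[of F] that by (auto simp: short_flow_def)
    qed
  qed
  have "real l * real (k * 2 ^ l) = (\<Sum>F\<in>?S. pmf mu F * (real l * real (k * 2 ^ l)))"
    using finS by (simp add: sum_pmf_eq_1 flip: sum_distrib_right)
  also have "\<dots> \<le> (\<Sum>F\<in>?S. pmf mu F * (32 * (\<Sum>p\<in>?P. DF F p)))"
    using big by (intro sum_mono mult_left_mono) auto
  also have "\<dots> = 32 * (\<Sum>F\<in>?S. \<Sum>p\<in>?P. pmf mu F * DF F p)"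
    by (simp add: sum_distrib_left mult.left_commute)
  also have "(\<Sum>F\<in>?S. \<Sum>p\<in>?P. pmf mu F * DF F p) = (\<Sum>p\<in>?P. D p)"
    unfolding D_def by (rule sum.swap)
  finally have large: "real l * real (k * 2 ^ l) \<le> 32 * (\<Sum>p\<in>?P. D p)" .
  have "0 < real l * real (k * 2 ^ l)" using l_pos k_pos by simp
  with large have "(\<Sum>p\<in>?P. D p) \<noteq> 0" by linarith
  then have "\<exists>p\<in>?P. D p \<noteq> 0" by (rule sum.not_neutral_contains_not_neutral) blast
  with D have "is_demand {..<k} D" unfolding is_demand_def by blast
  with sp have le: "cong net id {..<k} D \<le> ereal q' * cong ?H Inl {..<k} D" and "1 \<le> q'"
    unfolding flow_sparsifier_def by blast+
  have edges_H: "edges ?H = (SIGMA F:?S. edges (?C F))" by (auto simp: Hmu_def)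
  have ends_H: "ends ?H (F, e) = (tag F (fst (ends (?C F) e)), tag F (snd (ends (?C F) e)))" for F e
    by (simp add: Hmu_def)
  have "routes ?H Inl {..<k} D f"
    unfolding routes_def
  proof (intro ballI exI conjI)
    fix p assume p: "p \<in> ?P"
    show "Min p \<in> {..<k}" "Max p \<in> {..<k}" "Min p \<noteq> Max p" "p = {Min p, Max p}"
      using term_pair_Min_Max[OF p] by auto
    fix v :: "nat + nat set set \<times> nat set"
    let ?d = "(if v = Inl (Min p) then 1 else 0) - (if v = Inl (Max p) then 1 else 0) :: real"
    \<comment> \<open>The copy of \<open>F\<close> contributes its own balance at \<open>v\<close>.
      A vertex outside this copy is no terminal, since all copies share the terminals.\<close>
    have piece: "(\<Sum>e\<in>edges (?C F). (if fst (ends ?H (F, e)) = v then f p (F, e) else 0) -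
        (if snd (ends ?H (F, e)) = v then f p (F, e) else 0)) = pmf mu F * DF F p * ?d"
      if F: "F \<in> ?S" for F
    proof (cases "\<exists>x. v = tag F x")
      case True
      then obtain x where x: "v = tag F x" ..
      have "(\<Sum>e\<in>edges (?C F). (if fst (ends ?H (F, e)) = v then f p (F, e) else 0) -
          (if snd (ends ?H (F, e)) = v then f p (F, e) else 0)) = pmf mu F * netout (?C F) (fF F) p x"
        unfolding netout_def sum_distrib_left ends_H x fst_conv snd_conv inj_tag f_def
        by (intro sum.cong) (auto simp: right_diff_distrib)
      also have "netout (?C F) (fF F) p x =
          DF F p * ((if x = Inl (Min p) then 1 else 0) - (if x = Inl (Max p) then 1 else 0))"
        using sf[OF F] p unfolding short_flow_def by blast
      finally show ?thesis unfolding x tag_eq_Inl by (simp add: mult.assoc)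
    next
      case False
      then have "tag F x \<noteq> v" for x by blast
      moreover have "v \<noteq> Inl t" for t using False tag_eq_Inl[of F "Inl t" t] by metis
      ultimately show ?thesis by (simp add: ends_H)
    qed
    have "netout ?H f p v = (\<Sum>F\<in>?S. \<Sum>e\<in>edges (?C F). (if fst (ends ?H (F, e)) = v then f p (F, e) else 0) -
        (if snd (ends ?H (F, e)) = v then f p (F, e) else 0))"
      unfolding netout_def edges_H using finS finite_contract_edges
      by (subst sum.Sigma) (auto simp del: contract_simps intro!: sum.cong)
    also have "\<dots> = (\<Sum>F\<in>?S. pmf mu F * DF F p * ?d)" by (rule sum.cong[OF refl piece])
    also have "\<dots> = D p * ?d" unfolding D_def sum_distrib_right ..
    finally show "netout ?H f p v = D p * ?d" .
  qed
  moreover have "\<forall>e\<in>edges ?H. (\<Sum>p\<in>?P. \<bar>f p e\<bar>) \<le> 1 * cap ?H e"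
  proof
    fix e assume "e \<in> edges ?H"
    then obtain F e' where e: "e = (F, e')" "F \<in> ?S" "e' \<in> edges (?C F)" unfolding edges_H by blast
    have "(\<Sum>p\<in>?P. \<bar>f p e\<bar>) = pmf mu F * (\<Sum>p\<in>?P. \<bar>fF F p e'\<bar>)"
      by (simp add: e f_def abs_mult sum_distrib_left)
    also have "\<dots> \<le> pmf mu F * cap net e'"
      using sf[OF e(2)] e(3) unfolding short_flow_def by (intro mult_left_mono) auto
    finally show "(\<Sum>p\<in>?P. \<bar>f p e\<bar>) \<le> 1 * cap ?H e" by (simp add: e Hmu_def)
  qed
  ultimately have "cong ?H Inl {..<k} D \<le> ereal 1" unfolding cong_def by (intro Inf_lower) blast
  then have "ereal q' * cong ?H Inl {..<k} D \<le> ereal q' * ereal 1"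
    using \<open>1 \<le> q'\<close> by (intro ereal_mult_left_mono) auto
  with le have "cong net id {..<k} D \<le> ereal q'" by simp
  moreover have "ereal (real q / 192) \<le> cong net id {..<k} D"
    unfolding cong_def
  proof (rule Inf_greatest)
    fix y assume "y \<in> {ereal c | c. \<exists>f. routes net id {..<k} D f \<and>
      (\<forall>e\<in>edges net. (\<Sum>p\<in>?P. \<bar>f p e\<bar>) \<le> c * cap net e)}"
    then obtain c f where y: "y = ereal c" and "routes net id {..<k} D f"
      and "\<forall>e\<in>edges net. (\<Sum>p\<in>?P. \<bar>f p e\<bar>) \<le> c * cap net e" by blast
    then have "real q / 192 \<le> c" using congestion_ge[OF _ D _ large] by blast
    then show "ereal (real q / 192) \<le> y" by (simp add: y)
  qed
  ultimately show "real q / 192 \<le> q'" by (metis ereal_less_eq(3) order.trans)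
qed

end

section \<open>Choice of parameters\<close>

lemma exists_hard_graph:
  fixes k w q :: nat
  assumes "0 < q" "20 * q < w" "2 ^ (240 * w * q + 8) \<le> k"
  shows "\<exists>(G :: (nat, nat) graph) T. wf_graph G \<and> T \<subseteq> verts G \<and> card T = k \<and>
    (\<forall>mu s. s \<le> real (k * 2 ^ w) \<longrightarrow> conv_comb_size G T mu s \<longrightarrow> quality_at_least G T mu (real q / 192))"
proof -
  define l where "l = 3 * w"
  define g where "g = 4 * (3 * l * q + 2 * l) + 1"
  interpret star_system k l by unfold_locales (use assms in \<open>simp add: l_def\<close>)
  obtain H where H: "H \<subseteq> links" "\<And>v. card (incident H v) \<le> 4" "even_girth (spokes \<union> H) len spokes g"
    and large: "4 * (k * 2 ^ l) \<le> 2 * card H + 4 * 16 ^ g"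
    using high_girth_links[of g] by (auto simp: g_def)
  have "l \<le> l * q" using assms(1) by simp
  \<comment> \<open>The left side is \<open>144 * w * q + 96 * w + 8\<close>. It makes
    \<open>16 * 16 ^ g\<close> at most \<open>k\<close>, so the ball term in \<open>large\<close> is
    at most a quarter of \<open>k * 2 ^ l\<close>.\<close>
  then have "4 * (g + 1) \<le> 240 * w * q + 8" by (simp add: g_def l_def algebra_simps)
  then have "(2::nat) ^ (4 * (g + 1)) \<le> 2 ^ (240 * w * q + 8)" by (rule power_increasing) simp
  moreover have "(2::nat) ^ (4 * (g + 1)) = 16 * 16 ^ g" unfolding power_mult by simp
  ultimately have "16 * 16 ^ g \<le> k" using assms(3) by linarith
  also have "k \<le> k * 2 ^ l" by simp
  finally have "15 * (k * 2 ^ l) \<le> 8 * card H" using large by linarith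
  moreover have "0 < k" using assms(3) by (rule less_le_trans[rotated]) simp
  ultimately interpret sparse_net k l w q H
    by unfold_locales (use assms H in \<open>auto simp: l_def g_def\<close>)
  show ?thesis
    by (intro exI[of _ net] exI[of _ "{..<k}"]) (use wf_net quality_net in auto)
qed

text \<open>The bound \<open>1 / 3\<close> makes the size exponent \<open>b\<close> exceed the
  quality exponent \<open>a\<close>, so that \<open>20 * q < w\<close> eventually.\<close>

lemma c0_bounds: "0 < c0" "c0 \<le> 1 / 3"
proof -
  have "2 \<le> log 2 (5::real)" by (subst le_log_iff) auto
  then show "0 < c0" "c0 \<le> 1 / 3" unfolding c0_def by (auto simp: field_simps)
qed

theorem theorem1p1:
  shows "\<exists>C>0. \<exists>\<epsilon>0>0. \<forall>\<epsilon>::real. 0 < \<epsilon> \<and> \<epsilon> < \<epsilon>0 \<longrightarrow>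
     (\<exists>K::nat. \<forall>k\<ge>K. \<exists>(G::(nat, nat) graph) T.
        wf_graph G \<and> T \<subseteq> verts G \<and> card T = k \<and>
        (\<forall>mu. conv_comb_size G T mu (real k * 2 powr ((log 2 (real k)) powr (1 - c0 + \<epsilon>)))
              \<longrightarrow> quality_at_least G T mu ((log 2 (real k)) powr (c0 - C * \<epsilon>))))"
\<comment> \<open>The loss of 2 gives \<open>a + b = 1 - \<epsilon>\<close>, so \<open>w * q\<close>
  stays below \<open>log 2 k\<close>; \<open>\<epsilon> < c0 / 4\<close> keeps \<open>a\<close>
  positive.\<close>
proof (rule exI[of _ 2], intro conjI exI[of _ "c0 / 4"] allI impI)
  show "(0::real) < 2" "0 < c0 / 4" using c0_bounds by auto
  fix \<epsilon> :: real assume \<epsilon>: "0 < \<epsilon> \<and> \<epsilon> < c0 / 4"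
  define a b where "a = c0 - 2 * \<epsilon>" and "b = 1 - c0 + \<epsilon>"
  have ab: "0 < a" "0 < b" "0 < b - a" "0 < 1 - (a + b)" using \<epsilon> c0_bounds by (auto simp: a_def b_def)
  \<comment> \<open>\<open>3861 = 20 * 193 + 1\<close> serves \<open>20 * q < w\<close>, and
    \<open>92649 = 240 * 2 * 193 + 9\<close> serves the lower bound on \<open>k\<close>, with the
    roundings of \<open>w\<close> and \<open>q\<close> below.\<close>
  have "\<forall>\<^sub>F x::real in at_top. 1 \<le> x \<and> 3861 \<le> x powr (b - a) \<and> 92649 \<le> x powr (1 - (a + b))"
  proof -
    have "filterlim (\<lambda>x::real. x powr d) at_top at_top" if "0 < d" for d using that by real_asymp
    then show ?thesis using ab by (auto simp: eventually_conj_iff eventually_ge_at_top filterlim_at_top)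
  qed
  moreover have "filterlim (\<lambda>k::nat. log 2 (real k)) at_top sequentially" by real_asymp
  ultimately have "\<forall>\<^sub>F k in sequentially. 1 \<le> log 2 (real k) \<and> 3861 \<le> log 2 (real k) powr (b - a) \<and>
      92649 \<le> log 2 (real k) powr (1 - (a + b))"
    by (rule eventually_compose_filterlim)
  then obtain K where K: "\<And>k. k \<ge> K \<Longrightarrow> 1 \<le> log 2 (real k) \<and> 3861 \<le> log 2 (real k) powr (b - a) \<and>
      92649 \<le> log 2 (real k) powr (1 - (a + b))"
    by (auto simp: eventually_sequentially)
  show "\<exists>K::nat. \<forall>k\<ge>K. \<exists>(G::(nat, nat) graph) T.
        wf_graph G \<and> T \<subseteq> verts G \<and> card T = k \<and>
        (\<forall>mu. conv_comb_size G T mu (real k * 2 powr ((log 2 (real k)) powr (1 - c0 + \<epsilon>)))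
              \<longrightarrow> quality_at_least G T mu ((log 2 (real k)) powr (c0 - 2 * \<epsilon>)))"
  proof (intro exI[of _ K] allI impI)
    fix k :: nat assume "K \<le> k"
    define x where "x = log 2 (real k)"
    have x: "1 \<le> x" "3861 \<le> x powr (b - a)" "92649 \<le> x powr (1 - (a + b))"
      using K[OF \<open>K \<le> k\<close>] by (auto simp: x_def)
    \<comment> \<open>By convention \<open>log 2 0\<close> is 0, which is below 1.\<close>
    have "k \<noteq> 0"
    proof
      assume "k = 0"
      then have "x = 0" by (simp add: x_def log_def)
      then show False using x(1) by simp
    qed
    \<comment> \<open>Rounding up keeps \<open>k * 2 ^ w\<close> above the allowed size and
      \<open>q / 192\<close> above the required quality.\<close>
    define w q where "w = nat \<lceil>x powr b\<rceil>" and "q = nat \<lceil>192 * x powr a\<rceil>"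
    have xa: "1 \<le> x powr a" and xb: "1 \<le> x powr b" using x(1) ab by (auto intro!: ge_one_powr_ge_zero)
    have w: "x powr b \<le> w" "w \<le> 2 * x powr b" using xb by (simp_all add: w_def) linarith+
    have q: "192 * x powr a \<le> q" "q \<le> 193 * x powr a" using xa by (simp_all add: q_def) linarith+
    have "0 < q" using q(1) xa by linarith
    moreover have "20 * q < w"
    proof -
      have "20 * real q < 3861 * x powr a" using q(2) xa by linarith
      also have "\<dots> \<le> x powr (b - a) * x powr a" using x(2) by (intro mult_right_mono) auto
      also have "\<dots> = x powr b" by (simp flip: powr_add)
      finally have "20 * real q < real w" using w(1) by linarith
      then show ?thesis by linarith
    qed
    moreover have "2 ^ (240 * w * q + 8) \<le> k"
    proof -
      have "real w * real q \<le> (2 * x powr b) * (193 * x powr a)"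
        using w(2) q(2) by (intro mult_mono) auto
      then have "real (240 * w * q + 8) \<le> 92640 * (x powr b * x powr a) + 8" by (simp add: mult_ac)
      also have "\<dots> \<le> 92649 * (x powr b * x powr a)"
      proof -
        have "1 \<le> x powr b * x powr a" using mult_mono[OF xb xa] by simp
        then show ?thesis by linarith
      qed
      also have "\<dots> \<le> x powr (1 - (a + b)) * (x powr b * x powr a)"
        using x(3) by (intro mult_right_mono) auto
      also have "\<dots> = x" using x(1) by (simp add: algebra_simps flip: powr_add)
      finally have "2 powr real (240 * w * q + 8) \<le> 2 powr x" by simp
      also have "2 powr x = real k" using \<open>k \<noteq> 0\<close> by (simp add: x_def)
      finally have "real (2 ^ (240 * w * q + 8)) \<le> real k" by (simp only: powr_realpow) simp
      then show ?thesis by linarith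
    qed
    ultimately obtain G :: "(nat, nat) graph" and T where G: "wf_graph G" "T \<subseteq> verts G" "card T = k"
      "\<And>mu s. s \<le> real (k * 2 ^ w) \<Longrightarrow> conv_comb_size G T mu s \<Longrightarrow> quality_at_least G T mu (real q / 192)"
      using exists_hard_graph[of q w k] by blast
    have "2 powr (x powr b) \<le> 2 powr real w" using w(1) by simp
    then have size: "real k * 2 powr (x powr b) \<le> real (k * 2 ^ w)"
      by (simp add: powr_realpow mult_left_mono)
    have "x powr a \<le> real q / 192" using q(1) by simp
    then have "quality_at_least G T mu (x powr a)"
      if "conv_comb_size G T mu (real k * 2 powr (x powr b))" for mu
      using G(4)[OF size that] unfolding quality_at_least_def by (meson order.trans)
    with G(1-3) show "\<exists>(G::(nat, nat) graph) T.
        wf_graph G \<and> T \<subseteq> verts G \<and> card T = k \<and>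
        (\<forall>mu. conv_comb_size G T mu (real k * 2 powr ((log 2 (real k)) powr (1 - c0 + \<epsilon>)))
              \<longrightarrow> quality_at_least G T mu ((log 2 (real k)) powr (c0 - 2 * \<epsilon>)))"
      unfolding x_def a_def b_def by blast
  qed
qed

end
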